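(* There exists an algorithm that, given an instance $([n],\mathcal{T},w)$ of the WLLOC problem, computes an optimal solution, i.e. a map $f:[n]\to[0,1]$ minimizing the total weight of violated constraints, in time $O(n^{3n})$.
   Context: Weighted Line Learning with Ordinal Constraints (WLLOC): an instance is a triple $([n],\mathcal{T},w)$ where $\mathcal{T}$ is a set of ordered triples of distinct elements of $[n]=\{1,\dots,n\}$ and $w:\mathcal{T}\to\mathbb{R}$ is a weight function. A solution is a map $f:[n]\to[0,1]$; it violates the constraint $(i,j,k)\in\mathcal{T}$ unless $|f(i)-f(j)|<|f(i)-f(k)|$. The goal is to minimize the total weight of violated constraints. *)

theory Defs
  imports Complex_Main "HOL-Library.FuncSet" "HOL-Library.Landau_Symbols"
begin

section \<open>Weighted line learning with ordinal constraints\<close>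

type_synonym triple = "nat \<times> nat \<times> nat"

definition wlloc_instance :: "nat \<Rightarrow> triple set \<Rightarrow> bool" where
  "wlloc_instance n T \<longleftrightarrow>
     T \<subseteq> {(i, j, k). i \<in> {1..n} \<and> j \<in> {1..n} \<and> k \<in> {1..n} \<and> i \<noteq> j \<and> i \<noteq> k \<and> j \<noteq> k}"

definition violates :: "(nat \<Rightarrow> real) \<Rightarrow> triple \<Rightarrow> bool" where
  "violates f = (\<lambda>(i, j, k). \<not> \<bar>f i - f j\<bar> < \<bar>f i - f k\<bar>)"

definition violated_weight :: "triple set \<Rightarrow> (triple \<Rightarrow> real) \<Rightarrow> (nat \<Rightarrow> real) \<Rightarrow> real" where
  "violated_weight T w f = (\<Sum>\<tau> \<in> {\<tau> \<in> T. violates f \<tau>}. w \<tau>)"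

text \<open>
  The weight function is total on triples, but only its values on \<open>T\<close> matter; they may be
  negative. Likewise only the values of a solution on \<open>{1..n}\<close> matter.
\<close>

definition optimal_solution :: "nat \<Rightarrow> triple set \<Rightarrow> (triple \<Rightarrow> real) \<Rightarrow> (nat \<Rightarrow> real) \<Rightarrow> bool" where
  "optimal_solution n T w f \<longleftrightarrow>
     is_arg_min (violated_weight T w) (\<lambda>g. g \<in> {1..n} \<rightarrow> {0..1}) f"

section \<open>A real RAM\<close>

text \<open>
  Since the weights are arbitrary reals, the model of computation is the unit-cost real RAM,
  programmed in a structured while language. A state consists of an infinite natural-number
  memory and an infinite real memory, both indirectly addressable by natural numbers. Every node
  of an expression and every executed command costs one time unit.

  The instruction set is conservative: there is no multiplication of natural numbers, no
  rounding or other conversion between the two memories, and program constants are integers.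
  As in HOL, subtraction of natural numbers is truncated and division of reals by zero
  yields zero.
\<close>

type_synonym state = "(nat \<Rightarrow> nat) \<times> (nat \<Rightarrow> real)"

datatype nexp = NConst nat | NLoad nexp | NAdd nexp nexp | NSub nexp nexp

datatype rexp =
    RConst int | RLoad nexp
  | RAdd rexp rexp | RSub rexp rexp | RMul rexp rexp | RDiv rexp rexp

datatype bexp = NLess nexp nexp | RLess rexp rexp | BNot bexp | BAnd bexp bexp

datatype com =
    Skip
  | NStore nexp nexp
  | RStore nexp rexp
  | Seq com com
  | If bexp com com
  | While bexp com

primrec nval :: "nexp \<Rightarrow> state \<Rightarrow> nat" where
  "nval (NConst c) s = c"
| "nval (NLoad a) s = fst s (nval a s)"
| "nval (NAdd a b) s = nval a s + nval b s"
| "nval (NSub a b) s = nval a s - nval b s"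

primrec rval :: "rexp \<Rightarrow> state \<Rightarrow> real" where
  "rval (RConst c) s = of_int c"
| "rval (RLoad a) s = snd s (nval a s)"
| "rval (RAdd a b) s = rval a s + rval b s"
| "rval (RSub a b) s = rval a s - rval b s"
| "rval (RMul a b) s = rval a s * rval b s"
| "rval (RDiv a b) s = rval a s / rval b s"

primrec bval :: "bexp \<Rightarrow> state \<Rightarrow> bool" where
  "bval (NLess a b) s \<longleftrightarrow> nval a s < nval b s"
| "bval (RLess a b) s \<longleftrightarrow> rval a s < rval b s"
| "bval (BNot b) s \<longleftrightarrow> \<not> bval b s"
| "bval (BAnd a b) s \<longleftrightarrow> bval a s \<and> bval b s"

primrec ncost :: "nexp \<Rightarrow> nat" where
  "ncost (NConst c) = 1"
| "ncost (NLoad a) = 1 + ncost a"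
| "ncost (NAdd a b) = 1 + ncost a + ncost b"
| "ncost (NSub a b) = 1 + ncost a + ncost b"

primrec rcost :: "rexp \<Rightarrow> nat" where
  "rcost (RConst c) = 1"
| "rcost (RLoad a) = 1 + ncost a"
| "rcost (RAdd a b) = 1 + rcost a + rcost b"
| "rcost (RSub a b) = 1 + rcost a + rcost b"
| "rcost (RMul a b) = 1 + rcost a + rcost b"
| "rcost (RDiv a b) = 1 + rcost a + rcost b"

primrec bcost :: "bexp \<Rightarrow> nat" where
  "bcost (NLess a b) = 1 + ncost a + ncost b"
| "bcost (RLess a b) = 1 + rcost a + rcost b"
| "bcost (BNot b) = 1 + bcost b"
| "bcost (BAnd a b) = 1 + bcost a + bcost b"

text \<open>
  \<open>exec c s t s'\<close>: started in state \<open>s\<close>, the program \<open>c\<close> halts in state \<open>s'\<close> after exactly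
  \<open>t\<close> time units.
\<close>

inductive exec :: "com \<Rightarrow> state \<Rightarrow> nat \<Rightarrow> state \<Rightarrow> bool" where
  Skip: "exec Skip s 1 s"
| NStore: "exec (NStore a e) s (1 + ncost a + ncost e) ((fst s)(nval a s := nval e s), snd s)"
| RStore: "exec (RStore a e) s (1 + ncost a + rcost e) (fst s, (snd s)(nval a s := rval e s))"
| Seq: "exec c s t s' \<Longrightarrow> exec d s' t' s'' \<Longrightarrow> exec (Seq c d) s (1 + t + t') s''"
| IfTrue: "bval b s \<Longrightarrow> exec c s t s' \<Longrightarrow> exec (If b c d) s (1 + bcost b + t) s'"
| IfFalse: "\<not> bval b s \<Longrightarrow> exec d s t s' \<Longrightarrow> exec (If b c d) s (1 + bcost b + t) s'"
| WhileFalse: "\<not> bval b s \<Longrightarrow> exec (While b c) s (1 + bcost b) s"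
| WhileTrue: "bval b s \<Longrightarrow> exec c s t s' \<Longrightarrow> exec (While b c) s' t' s'' \<Longrightarrow>
    exec (While b c) s (1 + bcost b + t + t') s''"

inductive_cases SkipE: "exec Skip s t s'"
inductive_cases NStoreE: "exec (NStore a e) s t s'"
inductive_cases RStoreE: "exec (RStore a e) s t s'"
inductive_cases SeqE: "exec (Seq c d) s t s'"
inductive_cases IfE: "exec (If b c d) s t s'"
inductive_cases WhileE: "exec (While b c) s t s'"

lemma exec_deterministic:
  "exec c s t s' \<Longrightarrow> exec c s u s'' \<Longrightarrow> u = t \<and> s'' = s'"
proof (induction arbitrary: u s'' rule: exec.induct)
  case (Skip s) then show ?case by (rule SkipE) simp
next
  case (NStore a e s) then show ?case by (rule NStoreE) simp
next
  case (RStore a e s) then show ?case by (rule RStoreE) simp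
next
  case (Seq c s t s' d t' s1)
  from Seq.prems obtain v r v' where "exec c s v r" "exec d r v' s''" "u = Suc (v + v')"
    by (metis SeqE)
  with Seq.IH show ?case by (metis add_Suc plus_1_eq_Suc)
next
  case (IfTrue b s c t s' d)
  from IfTrue.prems IfTrue.hyps obtain v where "exec c s v s''" "u = Suc (bcost b + v)"
    by (metis IfE)
  with IfTrue.IH show ?case by (metis add_Suc plus_1_eq_Suc)
next
  case (IfFalse b s d t s' c)
  from IfFalse.prems IfFalse.hyps obtain v where "exec d s v s''" "u = Suc (bcost b + v)"
    by (metis IfE)
  with IfFalse.IH show ?case by (metis add_Suc plus_1_eq_Suc)
next
  case (WhileFalse b s c)
  from WhileFalse.prems WhileFalse.hyps show ?case by (metis WhileE plus_1_eq_Suc)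
next
  case (WhileTrue b s c t s' t' s1)
  from WhileTrue.prems WhileTrue.hyps obtain v r v'
    where "exec c s v r" "exec (While b c) r v' s''" "u = Suc (bcost b + v + v')"
    by (metis WhileE)
  with WhileTrue.IH show ?case by (metis add_Suc plus_1_eq_Suc)
qed

section \<open>Input and output\<close>

definition load :: "'a::zero list \<Rightarrow> nat \<Rightarrow> 'a" where
  "load xs a = (if a < length xs then xs ! a else 0)"

text \<open>
  An instance is presented as a list \<open>ts\<close> of its triples. The natural-number memory
  initially holds \<open>n\<close>, the number of triples, and then the triples one after the other; the real
  memory holds the weights in the same order. All other cells are zero.
\<close>

definition input_state :: "nat \<Rightarrow> triple list \<Rightarrow> (triple \<Rightarrow> real) \<Rightarrow> state" where
  "input_state n ts w =
     (load (n # length ts # concat (map (\<lambda>(i, j, k). [i, j, k]) ts)), load (map w ts))"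

text \<open>The computed map \<open>f\<close> is read off the real memory, with \<open>f i\<close> in cell \<open>i\<close>.\<close>

definition output_map :: "state \<Rightarrow> nat \<Rightarrow> real" where
  "output_map s = snd s"

end

theory Submission
  imports Defs "HOL-Real_Asymp.Real_Asymp"
begin

text \<open>
  Add a point \<open>0\<close> with \<open>f 0 = 0\<close>. Whether \<open>f\<close> violates a constraint depends only on the signs of the
  forms \<open>2 * f i - f j - f k\<close>, where \<open>j = k\<close> is allowed. The vectors with the same signs as \<open>f\<close> and with
  all nonzero forms of absolute value at least \<open>1\<close> make up a polyhedron, which has a vertex: a vector
  determined by \<open>n\<close> equations stating that forms have values in \<open>{-1, 0, 1}\<close>. The equations can be matched
  with the \<open>n\<close> unknowns so that each unknown occurs in its equation, which leaves at most
  \<open>6 * (n + 1)\<^sup>2\<close> equations for every unknown and \<open>(6 * (n + 1)\<^sup>2) ^ n\<close> systems in all. The algorithm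
  solves every system in polynomial time and keeps the best of the solutions after scaling them to the
  unit interval. A system is solved by successive projection onto the hyperplanes of its
  equations; where it is singular the outcome is an arbitrary vector, which does no harm after
  negative entries have been replaced by zero.
\<close>

section \<open>Sparse vertices\<close>

text \<open>The number of systems decides the running time. Listing \<open>n\<close> equations
  freely among \<open>(n + 1) ^ 3\<close> forms with three values each would give
  \<open>(3 * (n + 1) ^ 3) ^ n\<close> systems, which is not \<open>O(n ^ (3 * n))\<close>. Fixing
  one point of every form by the matching saves a factor of order \<open>n\<close> per equation; the
  saved \<open>n ^ n\<close> absorbs \<open>6 ^ n\<close> (two roles of the fixed point times three
  values) and every polynomial factor, so neither the solver nor the compiler has to be economical.
  The matching reflects that a nonsingular matrix has a nonzero term in its determinant. Signs
  decide violations because a difference of two squared distances factors into two of the forms. The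
  point \<open>0\<close> turns nonnegativity into a sign condition too, since the form of
  \<open>(u, 0, 0)\<close> is \<open>2 * f u\<close>; the upper end of the interval is free, as
  positive scaling keeps all signs. The slack \<open>1\<close> replaces strict inequalities by
  closed ones, whose bounds a vertex can attain.\<close>

text \<open>Full column rank of the matrix with rows \<open>S\<close> and columns \<open>V\<close>,
  expressed by a trivial kernel so that no determinants occur.\<close>

definition separating :: "('a \<Rightarrow> 'b \<Rightarrow> real) \<Rightarrow> 'a set \<Rightarrow> 'b set \<Rightarrow> bool" where
  "separating c S V \<longleftrightarrow> (\<forall>y. (\<forall>r\<in>S. (\<Sum>u\<in>V. c r u * y u) = 0) \<longrightarrow> (\<forall>u\<in>V. y u = 0))"

lemma separating_insertD:
  assumes "finite V" "v \<notin> V" "separating c S (insert v V)"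
  shows "separating c S V"
  unfolding separating_def
proof (intro allI impI ballI)
  fix y u
  assume y: "\<forall>r\<in>S. (\<Sum>u\<in>V. c r u * y u) = 0" and u: "u \<in> V"
  let ?z = "y(v := 0)"
  have "(\<Sum>u\<in>insert v V. c r u * ?z u) = (\<Sum>u\<in>V. c r u * y u)" for r
    using assms(1,2) by (simp, intro sum.cong) auto
  then have "\<forall>u\<in>insert v V. ?z u = 0" using assms(3) y unfolding separating_def by metis
  then show "y u = 0" using u assms(2) by (metis fun_upd_other insertI2)
qed

text \<open>Induction on the columns: rows that separate \<open>V\<close> leave a kernel of
  dimension at most one on \<open>insert v V\<close>, because a kernel vector vanishing at
  \<open>v\<close> vanishes altogether. One further row then suffices.\<close>

lemma separating_small_subset:
  assumes "finite V" "separating c S V"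
  shows "\<exists>S'\<subseteq>S. finite S' \<and> card S' \<le> card V \<and> separating c S' V"
  using assms
proof (induction V rule: finite_induct)
  case empty
  show ?case by (rule exI[of _ "{}"]) (simp add: separating_def)
next
  case (insert v V)
  let ?l = "\<lambda>r y. \<Sum>u\<in>insert v V. c r u * y u"
  from insert.IH[OF separating_insertD[OF insert.hyps(1,2) insert.prems]] obtain S' where
    S': "S' \<subseteq> S" "finite S'" "card S' \<le> card V" "separating c S' V" by blast
  show ?case
  proof (cases "separating c S' (insert v V)")
    case True
    then show ?thesis using S' insert.hyps by (intro exI[of _ S']) auto
  next
    case False
    then obtain y u0 where y: "\<forall>r\<in>S'. ?l r y = 0" and u0: "u0 \<in> insert v V" "y u0 \<noteq> 0"
      unfolding separating_def by blast
    have zero: "\<forall>u\<in>insert v V. w u = 0" if "\<forall>r\<in>S'. ?l r w = 0" "w v = 0" for w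
      using S'(4) that insert.hyps unfolding separating_def by simp
    have yv: "y v \<noteq> 0" using zero[OF y] u0 by blast
    obtain s where s: "s \<in> S" "?l s y \<noteq> 0"
      using insert.prems u0 unfolding separating_def by blast
    have "separating c (insert s S') (insert v V)"
      unfolding separating_def
    proof (intro allI impI)
      fix z assume z: "\<forall>r\<in>insert s S'. ?l r z = 0"
      \<comment> \<open>This combination of two kernel vectors of \<open>S'\<close> vanishes at
        \<open>v\<close>, hence everywhere; the new row \<open>s\<close> kills \<open>z\<close> but
        not \<open>y\<close>, which forces \<open>z v = 0\<close>.\<close>
      let ?w = "\<lambda>u. y v * z u - z v * y u"
      have lw: "?l r ?w = y v * ?l r z - z v * ?l r y" for r
        unfolding sum_distrib_left sum_subtractf[symmetric]
        by (rule sum.cong) (auto simp: algebra_simps)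
      have "\<forall>u\<in>insert v V. ?w u = 0"
        by (rule zero) (use y z lw in auto)
      then have "?l s ?w = 0" by (intro sum.neutral) auto
      then have "z v = 0" using lw[of s] z s by simp
      with \<open>\<forall>u\<in>insert v V. ?w u = 0\<close> yv show "\<forall>u\<in>insert v V. z u = 0" by auto
    qed
    moreover have "card (insert s S') \<le> card (insert v V)"
      using S' insert.hyps by (simp add: card_insert_if)
    ultimately show ?thesis using S' s by (intro exI[of _ "insert s S'"]) auto
  qed
qed

text \<open>Expanding a nonzero determinant along column \<open>v\<close> finds a nonzero entry with
  nonzero minor. The counterpart here is a row \<open>r\<close> with \<open>c r v \<noteq> 0\<close>
  that the other columns can spare; induction matches them inside \<open>S - {r}\<close>.\<close>

lemma separating_inj_choice:
  assumes "finite V" "finite S" "separating c S V"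
  shows "\<exists>e. inj_on e V \<and> e ` V \<subseteq> S \<and> (\<forall>v\<in>V. c (e v) v \<noteq> 0)"
  using assms
proof (induction V arbitrary: S rule: finite_induct)
  case empty
  then show ?case by simp
next
  case (insert v V)
  have sep: "separating c S V" by (rule separating_insertD[OF insert.hyps(1,2) insert.prems(2)])
  let ?l = "\<lambda>r y. \<Sum>u\<in>V. c r u * y u"
  have "\<exists>r\<in>S. c r v \<noteq> 0 \<and> separating c (S - {r}) V"
  proof (rule ccontr)
    assume neg: "\<not> ?thesis"
    define R where "R = {r \<in> S. c r v \<noteq> 0}"
    \<comment> \<open>If every row meeting column \<open>v\<close> is indispensable for
      \<open>V\<close>, dropping \<open>r\<close> frees a vector that \<open>r\<close> alone
      detects; scaled, it is a dual vector to \<open>r\<close>.\<close>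
    have "\<exists>y. \<forall>s\<in>S. ?l s y = (if s = r then 1 else 0)" if r: "r \<in> R" for r
    proof -
      have "\<not> separating c (S - {r}) V" using neg r by (auto simp: R_def)
      then obtain y u where y: "\<forall>s\<in>S - {r}. ?l s y = 0" "u \<in> V" "y u \<noteq> 0"
        unfolding separating_def by blast
      have "?l r y \<noteq> 0" using sep y unfolding separating_def by blast
      moreover have "?l s (\<lambda>u. y u / ?l r y) = ?l s y / ?l r y" for s
        by (simp add: sum_divide_distrib)
      ultimately show ?thesis using y(1) by (intro exI[of _ "\<lambda>u. y u / ?l r y"]) auto
    qed
    then obtain Y where Y: "\<And>r s. r \<in> R \<Longrightarrow> s \<in> S \<Longrightarrow> ?l s (Y r) = (if s = r then 1 else 0)"
      by metis
    \<comment> \<open>The dual vectors cancel column \<open>v\<close> in all rows at once, so this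
      is a kernel vector with value 1 at \<open>v\<close>.\<close>
    define z where "z u = (if u = v then 1 else - (\<Sum>r\<in>R. c r v * Y r u))" for u
    have "(\<Sum>u\<in>insert v V. c s u * z u) = 0" if s: "s \<in> S" for s
    proof -
      have "(\<Sum>u\<in>V. c s u * z u) = (\<Sum>u\<in>V. \<Sum>r\<in>R. - (c r v * (c s u * Y r u)))"
        using insert.hyps(2)
        by (intro sum.cong)
          (auto simp: z_def sum_distrib_left sum_negf[symmetric] algebra_simps intro!: sum.cong)
      also have "\<dots> = (\<Sum>r\<in>R. - (c r v * ?l s (Y r)))"
        by (subst sum.swap) (simp add: sum_distrib_left sum_negf)
      also have "\<dots> = (\<Sum>r\<in>R. if r = s then - c s v else 0)"
        using Y s by (intro sum.cong) auto
      also have "\<dots> = - c s v"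
        using insert.prems(1) s by (simp add: R_def)
      finally show ?thesis using insert.hyps by (simp add: z_def)
    qed
    then have "z v = 0" using insert.prems(2) unfolding separating_def by blast
    then show False by (simp add: z_def)
  qed
  then obtain r where r: "r \<in> S" "c r v \<noteq> 0" "separating c (S - {r}) V" by blast
  from insert.IH[OF _ r(3)] insert.prems(1) obtain e where
    e: "inj_on e V" "e ` V \<subseteq> S - {r}" "\<forall>v\<in>V. c (e v) v \<noteq> 0" by auto
  let ?e = "e(v := r)"
  have img: "?e ` V = e ` V" using insert.hyps(2) by (auto intro!: image_cong)
  have "inj_on ?e V" using e(1) insert.hyps(2) by (auto simp: inj_on_def)
  then have "inj_on ?e (insert v V)"
    using insert.hyps(2) img e(2) by auto
  moreover have "?e ` insert v V \<subseteq> S" using img e(2) r(1) by auto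
  moreover have "\<forall>u\<in>insert v V. c (?e u) u \<noteq> 0" using e(3) r(2) by auto
  ultimately show ?case by blast
qed

text \<open>The size bound on \<open>S'\<close> joins the two previous lemmas: an injective choice
  of rows from \<open>S'\<close> must exhaust it, so the matched rows still separate.\<close>

lemma separating_choice:
  assumes "finite V" "separating c S V"
  shows "\<exists>e. e ` V \<subseteq> S \<and> (\<forall>v\<in>V. c (e v) v \<noteq> 0) \<and> separating c (e ` V) V"
proof -
  obtain S' where S': "S' \<subseteq> S" "finite S'" "card S' \<le> card V" "separating c S' V"
    using separating_small_subset[OF assms] by blast
  obtain e where e: "inj_on e V" "e ` V \<subseteq> S'" "\<forall>v\<in>V. c (e v) v \<noteq> 0"
    using separating_inj_choice[OF assms(1) S'(2,4)] by blast
  have "e ` V = S'"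
    using S' e by (intro card_seteq) (auto simp: card_image)
  then show ?thesis using S' e by blast
qed

section \<open>Linear forms of triples and vertices of their sign regions\<close>

text \<open>Its sign tells on which side of the midpoint of \<open>x j\<close> and
  \<open>x k\<close> the point \<open>x i\<close> lies; for \<open>j = k\<close> it compares two
  points.\<close>

definition lin :: "triple \<Rightarrow> (nat \<Rightarrow> real) \<Rightarrow> real" where
  "lin = (\<lambda>(i, j, k) x. 2 * x i - x j - x k)"

definition coef :: "triple \<Rightarrow> nat \<Rightarrow> real" where
  "coef = (\<lambda>(i, j, k) u. 2 * of_bool (u = i) - of_bool (u = j) - of_bool (u = k))"

definition points :: "nat \<Rightarrow> triple set" where
  "points n = {..n} \<times> {..n} \<times> {..n}"

lemma lin_eq_sum:
  assumes "\<tau> \<in> points n" "x 0 = 0"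
  shows "lin \<tau> x = (\<Sum>u\<in>{1..n}. coef \<tau> u * x u)"
proof -
  have *: "(\<Sum>u\<in>{1..n}. of_bool (u = i) * x u) = x i" if "i \<le> n" for i
  proof -
    have "(\<Sum>u\<in>{1..n}. of_bool (u = i) * x u) = (\<Sum>u\<in>{1..n}. if u = i then x u else 0)"
      by (intro sum.cong) auto
    then show ?thesis using that assms(2) by (cases i) auto
  qed
  obtain i j k where \<tau>: "\<tau> = (i, j, k)" by (cases \<tau>)
  have "(\<Sum>u\<in>{1..n}. coef \<tau> u * x u) =
     2 * (\<Sum>u\<in>{1..n}. of_bool (u = i) * x u) - (\<Sum>u\<in>{1..n}. of_bool (u = j) * x u)
       - (\<Sum>u\<in>{1..n}. of_bool (u = k) * x u)"
    unfolding sum_distrib_left sum_subtractf[symmetric]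
    by (rule sum.cong) (auto simp: \<tau> coef_def algebra_simps)
  then show ?thesis using assms(1) * by (simp add: \<tau> lin_def points_def)
qed

lemma finite_points: "finite (points n)" by (simp add: points_def)

lemma lin_add: "lin \<tau> (\<lambda>u. x u + t * y u) = lin \<tau> x + t * lin \<tau> y"
  by (cases \<tau>) (simp add: lin_def algebra_simps)

lemma lin_diff: "lin \<tau> (\<lambda>u. x u - y u) = lin \<tau> x - lin \<tau> y"
  by (cases \<tau>) (simp add: lin_def algebra_simps)

lemma lin_scale: "lin \<tau> (\<lambda>u. t * y u) = t * lin \<tau> y"
  by (cases \<tau>) (simp add: lin_def algebra_simps)

lemma lin_scale_right: "lin \<tau> (\<lambda>u. y u * t) = lin \<tau> y * t"
  by (cases \<tau>) (simp add: lin_def algebra_simps)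

lemma lin_sum: "lin \<tau> (\<lambda>u. \<Sum>w\<in>A. g u w) = (\<Sum>w\<in>A. lin \<tau> (\<lambda>u. g u w))"
  by (cases \<tau>) (simp add: lin_def sum_subtractf sum_distrib_left)

lemma lin_swap: "lin \<sigma> (\<lambda>w. lin \<tau> (\<lambda>z. g w z)) = lin \<tau> (\<lambda>z. lin \<sigma> (\<lambda>w. g w z))"
  by (cases \<tau>; cases \<sigma>) (simp add: lin_def algebra_simps)

lemma lin_cong:
  assumes "\<tau> \<in> points n" "\<And>u. u \<le> n \<Longrightarrow> x u = y u"
  shows "lin \<tau> x = lin \<tau> y"
  using assms by (cases \<tau>) (auto simp: lin_def points_def)

text \<open>
  Among the vectors of the polyhedron cut out by the sign pattern of \<open>f\<close> with slack \<open>1\<close> in the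
  strict inequalities, one with the largest set of tight constraints is a vertex: otherwise it
  could be moved until a further constraint becomes tight.
\<close>

lemma vertex_exists:
  assumes f0: "f 0 = 0"
  shows "\<exists>x. x 0 = 0 \<and> (\<forall>\<tau>\<in>points n. sgn (lin \<tau> x) = sgn (lin \<tau> f)) \<and>
    separating coef {\<tau> \<in> points n. lin \<tau> x \<in> {-1, 0, 1}} {1..n}"
proof -
  define Q where "Q x \<longleftrightarrow> x 0 = 0 \<and>
    (\<forall>\<tau>\<in>points n. sgn (lin \<tau> x) = sgn (lin \<tau> f) \<and> (lin \<tau> x \<noteq> 0 \<longrightarrow> 1 \<le> \<bar>lin \<tau> x\<bar>))" for x
  \<comment> \<open>On \<open>Q\<close> a modulus of at most 1 means one of the values -1, 0 and 1,
    so vanishing forms count as tight as well.\<close>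
  define tight where "tight x = {\<tau> \<in> points n. \<bar>lin \<tau> x\<bar> \<le> 1}" for x
  obtain x0 where x0: "Q x0"
  proof -
    let ?A = "insert 1 ((\<lambda>\<tau>. \<bar>lin \<tau> f\<bar>) ` {\<tau> \<in> points n. lin \<tau> f \<noteq> 0})"
    \<comment> \<open>Dividing by the least nonzero modulus carries \<open>f\<close> into the
      polyhedron; the inserted \<open>1\<close> keeps the set nonempty.\<close>
    define a where "a = Min ?A"
    have fin: "finite ?A" using finite_points by auto
    have a: "0 < a" using fin unfolding a_def by (subst Min_gr_iff) auto
    have "Q (\<lambda>u. inverse a * f u)"
      unfolding Q_def
    proof (intro conjI ballI impI)
      fix \<tau> assume \<tau>: "\<tau> \<in> points n"
      show "sgn (lin \<tau> (\<lambda>u. inverse a * f u)) = sgn (lin \<tau> f)"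
        using a by (simp add: lin_scale sgn_mult)
      assume "lin \<tau> (\<lambda>u. inverse a * f u) \<noteq> 0"
      then have "a \<le> \<bar>lin \<tau> f\<bar>"
        using \<tau> fin unfolding a_def by (intro Min_le) (auto simp: lin_scale)
      then show "1 \<le> \<bar>lin \<tau> (\<lambda>u. inverse a * f u)\<bar>"
        unfolding lin_scale abs_mult using a by (simp add: field_simps)
    qed (simp add: f0)
    then show ?thesis by (rule that)
  qed
  have "card (tight x) < Suc (card (points n))" for x
    unfolding less_Suc_eq_le by (rule card_mono) (auto simp: finite_points tight_def)
  then obtain x where x: "Q x" "\<And>z. Q z \<Longrightarrow> card (tight z) \<le> card (tight x)"
    using ex_has_greatest_nat[of Q x0 "\<lambda>x. card (tight x)" "Suc (card (points n))"] x0 by auto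
  have "separating coef (tight x) {1..n}"
    unfolding separating_def
  proof (rule ccontr)
    assume "\<not> (\<forall>y. (\<forall>\<tau>\<in>tight x. (\<Sum>u\<in>{1..n}. coef \<tau> u * y u) = 0) \<longrightarrow> (\<forall>u\<in>{1..n}. y u = 0))"
    then obtain y0 v where y0: "\<forall>\<tau>\<in>tight x. (\<Sum>u\<in>{1..n}. coef \<tau> u * y0 u) = 0"
      and v: "v \<in> {1..n}" "y0 v \<noteq> 0" by blast
    \<comment> \<open>\<open>separating\<close> says nothing about coordinate \<open>0\<close>,
      which the forms do read; hence the reset.\<close>
    define y where "y = y0(0 := 0)"
    have y_sum: "(\<Sum>u\<in>{1..n}. coef \<tau> u * y0 u) = (\<Sum>u\<in>{1..n}. coef \<tau> u * y u)" for \<tau>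
      by (rule sum.cong) (auto simp: y_def)
    have y: "lin \<tau> y = 0" if "\<tau> \<in> tight x" for \<tau>
    proof -
      have "\<tau> \<in> points n" "y 0 = 0" using that by (auto simp: y_def tight_def)
      then show ?thesis using bspec[OF y0 that] unfolding y_sum by (simp only: lin_eq_sum)
    qed
    define B where "B = {\<tau> \<in> points n. lin \<tau> y \<noteq> 0}"
    \<comment> \<open>Moving by \<open>t \<tau>\<close> along \<open>y\<close> takes the form of
      \<open>\<tau>\<close> to 1 or -1 according to its sign; the least modulus marks the first such
      event in either direction.\<close>
    define t where "t \<tau> = (sgn (lin \<tau> x) - lin \<tau> x) / lin \<tau> y" for \<tau>
    \<comment> \<open>This form equals \<open>2 * y v\<close>, so some form does change along
      \<open>y\<close>: the coordinates are among the forms, which is why the polyhedron contains no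
      line.\<close>
    have "(v, 0, 0) \<in> B" using v by (auto simp: B_def points_def lin_def y_def)
    then obtain \<sigma> where \<sigma>: "\<sigma> \<in> B" "\<And>\<tau>. \<tau> \<in> B \<Longrightarrow> \<bar>t \<sigma>\<bar> \<le> \<bar>t \<tau>\<bar>"
      using ex_is_arg_min_if_finite[of B "\<lambda>\<tau>. \<bar>t \<tau>\<bar>"] finite_points
      by (force simp: B_def is_arg_min_linorder)
    define x' where "x' = (\<lambda>u. x u + t \<sigma> * y u)"
    have lx': "lin \<tau> x' = lin \<tau> x + t \<sigma> * lin \<tau> y" for \<tau> unfolding x'_def by (rule lin_add)
    \<comment> \<open>A form in \<open>B\<close> has modulus above 1 and is shifted by at most its
      distance to 1 or -1, so it cannot pass that value.\<close>
    have move: "sgn (lin \<tau> x') = sgn (lin \<tau> x) \<and> 1 \<le> \<bar>lin \<tau> x'\<bar>" if \<tau>: "\<tau> \<in> B" for \<tau>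
    proof -
      have "1 < \<bar>lin \<tau> x\<bar>" using \<tau> y[of \<tau>] by (auto simp: B_def tight_def not_le[symmetric])
      have "\<bar>t \<sigma> * lin \<tau> y\<bar> \<le> \<bar>t \<tau> * lin \<tau> y\<bar>"
        using \<sigma>(2)[OF \<tau>] by (simp add: abs_mult mult_right_mono)
      also have "t \<tau> * lin \<tau> y = sgn (lin \<tau> x) - lin \<tau> x"
        using \<tau> by (simp add: t_def B_def)
      finally show ?thesis
        using \<open>1 < \<bar>lin \<tau> x\<bar>\<close> unfolding lx' by (auto simp: sgn_if abs_if split: if_splits)
    qed
    have stay: "lin \<tau> x' = lin \<tau> x" if "\<tau> \<in> points n" "\<tau> \<notin> B" for \<tau>
      using that by (simp add: lx' B_def)
    have "Q x'"
      unfolding Q_def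
    proof (intro conjI ballI)
      show "x' 0 = 0" using x(1) by (simp add: x'_def y_def Q_def)
      fix \<tau> assume \<tau>: "\<tau> \<in> points n"
      have "sgn (lin \<tau> x) = sgn (lin \<tau> f)" "lin \<tau> x \<noteq> 0 \<longrightarrow> 1 \<le> \<bar>lin \<tau> x\<bar>"
        using x(1) \<tau> unfolding Q_def by blast+
      then show "sgn (lin \<tau> x') = sgn (lin \<tau> f)" "lin \<tau> x' \<noteq> 0 \<longrightarrow> 1 \<le> \<bar>lin \<tau> x'\<bar>"
        using move[of \<tau>] stay[OF \<tau>] by (cases "\<tau> \<in> B"; simp)+
    qed
    have "tight x \<subseteq> tight x'"
    proof
      fix \<tau> assume "\<tau> \<in> tight x"
      then show "\<tau> \<in> tight x'" using y[of \<tau>] lx'[of \<tau>] by (simp add: tight_def)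
    qed
    moreover have "\<sigma> \<notin> tight x" using \<sigma>(1) y[of \<sigma>] by (auto simp: B_def)
    moreover have "\<sigma> \<in> tight x'"
    proof -
      have "lin \<sigma> x' = sgn (lin \<sigma> x)" using \<sigma>(1) by (simp add: lx' t_def B_def)
      then show ?thesis using \<sigma>(1) by (simp add: tight_def B_def abs_sgn_eq)
    qed
    ultimately have "tight x \<subset> tight x'" by blast
    then have "card (tight x) < card (tight x')"
      by (intro psubset_card_mono) (auto simp: tight_def finite_points)
    with x(2)[OF \<open>Q x'\<close>] show False by simp
  qed
  moreover have "tight x = {\<tau> \<in> points n. lin \<tau> x \<in> {-1, 0, 1}}"
    using x(1) by (force simp: tight_def Q_def)
  ultimately show ?thesis using x(1) unfolding Q_def by auto
qed

text \<open>The tight forms at a vertex have full rank, so one of them can be assigned to each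
  unknown in such a way that these \<open>n\<close> equations still determine the vertex.\<close>

lemma sparse_vertex_exists:
  assumes "f 0 = 0"
  shows "\<exists>x e. x 0 = 0 \<and> (\<forall>\<tau>\<in>points n. sgn (lin \<tau> x) = sgn (lin \<tau> f)) \<and>
    (\<forall>v\<in>{1..n}. (\<exists>a\<le>n. \<exists>b\<le>n. e v = (v, a, b) \<or> e v = (a, v, b)) \<and> lin (e v) x \<in> {-1, 0, 1}) \<and>
    (\<forall>y. y 0 = 0 \<longrightarrow> (\<forall>v\<in>{1..n}. lin (e v) y = 0) \<longrightarrow> (\<forall>u\<le>n. y u = 0))"
proof -
  obtain x where x: "x 0 = 0" "\<forall>\<tau>\<in>points n. sgn (lin \<tau> x) = sgn (lin \<tau> f)"
    and sep: "separating coef {\<tau> \<in> points n. lin \<tau> x \<in> {-1, 0, 1}} {1..n}"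
    using vertex_exists[of f, OF assms] by blast
  obtain e where e: "e ` {1..n} \<subseteq> {\<tau> \<in> points n. lin \<tau> x \<in> {-1, 0, 1}}"
    "\<forall>v\<in>{1..n}. coef (e v) v \<noteq> 0" "separating coef (e ` {1..n}) {1..n}"
    using separating_choice[OF _ sep] by blast
  have "\<exists>\<tau>. (\<exists>a\<le>n. \<exists>b\<le>n. \<tau> = (v, a, b) \<or> \<tau> = (a, v, b)) \<and> (\<forall>y. lin \<tau> y = lin (e v) y)"
    if v: "v \<in> {1..n}" for v
  proof -
    obtain i j k where ev: "e v = (i, j, k)" by (cases "e v")
    have "(i, j, k) \<in> points n" using e(1) v ev by force
    then have le: "i \<le> n" "j \<le> n" "k \<le> n" by (auto simp: points_def)
    have "coef (i, j, k) v \<noteq> 0" using e(2) v ev by metis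
    then have "v = i \<or> v = j \<or> v = k" by (auto simp: coef_def)
    then consider "e v = (v, j, k)" | "e v = (i, v, k)" | "e v = (i, j, v)" using ev by blast
    then show ?thesis
    proof cases
      \<comment> \<open>The forms are symmetric in their last two points, so only two roles of the
        unknown have to be enumerated.\<close>
      case 3
      then show ?thesis using le by (intro exI[of _ "(i, v, j)"]) (auto simp: lin_def)
    qed (use le in blast)+
  qed
  then obtain e' where e': "\<And>v. v \<in> {1..n} \<Longrightarrow> \<exists>a\<le>n. \<exists>b\<le>n. e' v = (v, a, b) \<or> e' v = (a, v, b)"
    "\<And>v y. v \<in> {1..n} \<Longrightarrow> lin (e' v) y = lin (e v) y" by metis
  have "\<forall>u\<le>n. y u = 0" if y: "y 0 = 0" "\<forall>v\<in>{1..n}. lin (e' v) y = 0" for y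
  proof -
    have "(\<Sum>u\<in>{1..n}. coef \<tau> u * y u) = 0" if "\<tau> \<in> e ` {1..n}" for \<tau>
      using that e(1) lin_eq_sum[of \<tau> n y] y e'(2) by auto
    then have "\<forall>u\<in>{1..n}. y u = 0" using e(3) unfolding separating_def by blast
    then show ?thesis using y(1) by (metis atLeastAtMost_iff less_one not_le)
  qed
  moreover have "lin (e' v) x \<in> {-1, 0, 1}" if "v \<in> {1..n}" for v
  proof -
    have "e v \<in> {\<tau> \<in> points n. lin \<tau> x \<in> {-1, 0, 1}}" using e(1) that by blast
    then show ?thesis by (simp add: e'(2)[OF that])
  qed
  ultimately show ?thesis using x e'(1) by blast
qed

text \<open>
  \<open>P\<close> is the orthogonal projection onto the common kernel of the forms in \<open>A\<close>, and
  \<open>z - x\<close> lies in its range.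
\<close>

definition projection_inv ::
  "nat \<Rightarrow> triple set \<Rightarrow> (nat \<Rightarrow> real) \<Rightarrow> (nat \<Rightarrow> nat \<Rightarrow> real) \<Rightarrow> (nat \<Rightarrow> real) \<Rightarrow> bool" where
  "projection_inv n A z P x \<longleftrightarrow>
     (\<forall>u\<le>n. \<forall>v\<le>n. P u v = P v u) \<and>
     (\<forall>u\<le>n. \<forall>v\<le>n. (\<Sum>w\<le>n. P u w * P w v) = P u v) \<and>
     (\<forall>\<tau>\<in>A. \<forall>u\<le>n. lin \<tau> (\<lambda>w. P w u) = 0) \<and>
     (\<forall>u\<le>n. (\<Sum>w\<le>n. P u w * (z w - x w)) = z u - x u) \<and>
     (\<forall>u\<le>n. P 0 u = 0)"

text \<open>The start is the projection onto the vectors with zero \<open>0\<close>-th entry, so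
  \<open>x 0 = 0\<close> costs no equation of its own.\<close>

lemma projection_inv_init:
  assumes "z 0 = 0" "\<And>u w. u \<le> n \<Longrightarrow> w \<le> n \<Longrightarrow> P u w = (if u = w \<and> u \<noteq> 0 then 1 else 0)"
    "\<And>u. u \<le> n \<Longrightarrow> x u = 0"
  shows "projection_inv n {} z P x"
proof -
  have "(\<Sum>w\<le>n. P u w * g w) = (if u = 0 then 0 else g u)" if "u \<le> n" for u g
  proof -
    have "(\<Sum>w\<le>n. P u w * g w) = (\<Sum>w\<le>n. if u = w then (if u = 0 then 0 else g u) else 0)"
      using assms(2) that by (intro sum.cong) auto
    then show ?thesis using that by simp
  qed
  then show ?thesis using assms unfolding projection_inv_def by auto
qed

text \<open>A Gram-Schmidt step: \<open>d\<close> is the image under \<open>P\<close> of the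
  coefficient vector of \<open>\<tau>\<close>, and \<open>lin \<tau> d\<close> is its squared
  length. If that is nonzero, \<open>x\<close> moves along \<open>d\<close> until
  \<open>\<tau>\<close> has the same value as at \<open>z\<close>, and \<open>P\<close> loses the
  direction \<open>d\<close>.\<close>

lemma projection_inv_step:
  fixes x :: "nat \<Rightarrow> real"
  assumes inv: "projection_inv n A z P x" and \<tau>: "\<tau> \<in> points n" and A: "A \<subseteq> points n"
    and d: "\<And>u. u \<le> n \<Longrightarrow> d u = lin \<tau> (P u)"
    and x': "\<And>u. u \<le> n \<Longrightarrow> x' u = x u + d u * ((lin \<tau> z - lin \<tau> x) / lin \<tau> d)"
    and P': "\<And>u w. u \<le> n \<Longrightarrow> w \<le> n \<Longrightarrow> P' u w = P u w - d u * d w / lin \<tau> d"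
  shows "projection_inv n (insert \<tau> A) z P' x'"
proof -
  have sym: "\<And>u v. u \<le> n \<Longrightarrow> v \<le> n \<Longrightarrow> P u v = P v u"
    and idem: "\<And>u v. u \<le> n \<Longrightarrow> v \<le> n \<Longrightarrow> (\<Sum>w\<le>n. P u w * P w v) = P u v"
    and ann: "\<And>\<sigma> u. \<sigma> \<in> A \<Longrightarrow> u \<le> n \<Longrightarrow> lin \<sigma> (\<lambda>w. P w u) = 0"
    and res: "\<And>u. u \<le> n \<Longrightarrow> (\<Sum>w\<le>n. P u w * (z w - x w)) = z u - x u"
    and P0: "\<And>u. u \<le> n \<Longrightarrow> P 0 u = 0"
    using inv unfolding projection_inv_def by auto
  define q where "q = lin \<tau> d"
  have d_weighted: "(\<Sum>w\<le>n. d w * g w) = lin \<tau> (\<lambda>u. \<Sum>w\<le>n. P u w * g w)" for g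
  proof -
    have "(\<Sum>w\<le>n. d w * g w) = (\<Sum>w\<le>n. lin \<tau> (\<lambda>u. P w u * g w))"
      by (intro sum.cong) (auto simp: d lin_scale_right)
    also have "\<dots> = lin \<tau> (\<lambda>u. \<Sum>w\<le>n. P w u * g w)" by (simp add: lin_sum)
    also have "\<dots> = lin \<tau> (\<lambda>u. \<Sum>w\<le>n. P u w * g w)"
      using sym by (intro lin_cong[OF \<tau>] sum.cong) auto
    finally show ?thesis .
  qed
  have Pd: "(\<Sum>w\<le>n. P u w * d w) = d u" if u: "u \<le> n" for u
  proof -
    have "(\<Sum>w\<le>n. P u w * d w) = (\<Sum>w\<le>n. lin \<tau> (\<lambda>v. P u w * P w v))"
      by (intro sum.cong) (auto simp: d lin_scale)
    also have "\<dots> = lin \<tau> (\<lambda>v. \<Sum>w\<le>n. P u w * P w v)" by (simp add: lin_sum)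
    also have "\<dots> = lin \<tau> (P u)" using idem u by (intro lin_cong[OF \<tau>]) auto
    finally show ?thesis using d u by simp
  qed
  have dP: "(\<Sum>w\<le>n. d w * P w u) = d u" if "u \<le> n" for u
  proof -
    have "(\<Sum>w\<le>n. d w * P w u) = (\<Sum>w\<le>n. P u w * d w)"
      using sym[OF _ that] by (intro sum.cong refl) (metis atMost_iff mult.commute)
    then show ?thesis using Pd[OF that] by simp
  qed
  have dd: "(\<Sum>w\<le>n. d w * d w) = q"
    unfolding d_weighted q_def using Pd by (intro lin_cong[OF \<tau>]) auto
  have dz: "(\<Sum>w\<le>n. d w * (z w - x w)) = lin \<tau> z - lin \<tau> x"
    unfolding d_weighted lin_diff[symmetric] using res by (intro lin_cong[OF \<tau>]) auto
  have lin_col: "lin \<tau> (\<lambda>w. P w u) = d u" if "u \<le> n" for u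
    using that sym d by (auto intro!: lin_cong[OF \<tau>])
  show ?thesis
  proof (cases "q = 0")
    \<comment> \<open>The squared length is zero, so \<open>d\<close> vanishes and nothing moves;
      \<open>\<tau>\<close> already annihilates the columns of \<open>P\<close>.\<close>
    case True
    have "\<forall>w\<in>{..n}. d w * d w = 0"
      using dd True by (subst sum_nonneg_eq_0_iff[symmetric]) auto
    then have d0: "d u = 0" if "u \<le> n" for u using that by auto
    have "lin \<sigma> (\<lambda>w. P' w u) = lin \<sigma> (\<lambda>w. P w u)" if "\<sigma> \<in> points n" "u \<le> n" for \<sigma> u
      using that by (intro lin_cong) (auto simp: P' d0)
    then have "\<forall>\<sigma>\<in>insert \<tau> A. \<forall>u\<le>n. lin \<sigma> (\<lambda>w. P' w u) = 0"
      using ann lin_col d0 \<tau> A by auto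
    then show ?thesis
      using sym idem res P0 unfolding projection_inv_def by (auto simp: P' x' d0)
  next
    case False
    define c where "c = (lin \<tau> z - lin \<tau> x) / q"
    have x'': "x' u = x u + d u * c" if "u \<le> n" for u using x'[OF that] by (simp add: c_def q_def)
    have P'': "P' u w = P u w - d u * d w / q" if "u \<le> n" "w \<le> n" for u w
      using P'[OF that] by (simp add: q_def)
    have cq: "lin \<tau> z - lin \<tau> x = c * q" using False by (simp add: c_def)
    have sym': "P' u v = P' v u" if "u \<le> n" "v \<le> n" for u v
      using that sym by (simp add: P'')
    have idem': "(\<Sum>w\<le>n. P' u w * P' w v) = P' u v" if uv: "u \<le> n" "v \<le> n" for u v
    proof -
      have "(\<Sum>w\<le>n. P' u w * P' w v) = (\<Sum>w\<le>n. P u w * P w v - d v / q * (P u w * d w)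
          - d u / q * (d w * P w v) + d u * d v / q\<^sup>2 * (d w * d w))"
        using uv by (intro sum.cong) (auto simp: P'' divide_inverse power2_eq_square algebra_simps)
      also have "\<dots> = P u v - d v / q * d u - d u / q * d v + d u * d v / q\<^sup>2 * q"
        unfolding sum.distrib sum_subtractf sum_distrib_left[symmetric] dd
        by (simp only: idem[OF uv] Pd[OF uv(1)] dP[OF uv(2)])
      also have "\<dots> = P' u v" using False uv by (simp add: P'' power2_eq_square)
      finally show ?thesis .
    qed
    have ann': "lin \<sigma> (\<lambda>w. P' w u) = 0" if \<sigma>: "\<sigma> \<in> insert \<tau> A" and u: "u \<le> n" for \<sigma> u
    proof -
      have \<sigma>': "\<sigma> \<in> points n" using \<sigma> \<tau> A by auto
      have eq: "lin \<sigma> (\<lambda>w. P' w u) = lin \<sigma> (\<lambda>w. P w u) - d u / q * lin \<sigma> d"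
        unfolding lin_scale[symmetric] lin_diff[symmetric]
        using u by (intro lin_cong[OF \<sigma>']) (auto simp: P'')
      show ?thesis
      proof (cases "\<sigma> = \<tau>")
        case True
        then show ?thesis using eq lin_col[OF u] False by (simp add: q_def)
      next
        case ne: False
        \<comment> \<open>\<open>d\<close> is a combination of columns of \<open>P\<close>, and the
          earlier form \<open>\<sigma>\<close> vanishes on each of them.\<close>
        then have "lin \<sigma> d = lin \<sigma> (\<lambda>w. lin \<tau> (P w))"
          using d by (intro lin_cong[OF \<sigma>']) auto
        also have "\<dots> = lin \<tau> (\<lambda>v. lin \<sigma> (\<lambda>w. P w v))" by (rule lin_swap)
        also have "\<dots> = lin \<tau> (\<lambda>v. 0)" using ann ne \<sigma> by (intro lin_cong[OF \<tau>]) auto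
        finally show ?thesis using eq ann ne \<sigma> u by (cases \<tau>) (auto simp: lin_def)
      qed
    qed
    have res': "(\<Sum>w\<le>n. P' u w * (z w - x' w)) = z u - x' u" if u: "u \<le> n" for u
    proof -
      have "(\<Sum>w\<le>n. P' u w * (z w - x' w)) = (\<Sum>w\<le>n. P u w * (z w - x w) - c * (P u w * d w)
          - d u / q * (d w * (z w - x w)) + d u * c / q * (d w * d w))"
        using u by (intro sum.cong) (auto simp: P'' x'' divide_inverse algebra_simps)
      also have "\<dots> = z u - x u - c * d u - d u / q * (c * q) + d u * c / q * q"
        unfolding sum.distrib sum_subtractf sum_distrib_left[symmetric] dd
        by (simp only: res[OF u] Pd[OF u] dz cq)
      also have "\<dots> = z u - x' u" using False u by (simp add: x'')
      finally show ?thesis .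
    qed
    have "d 0 = 0" using P0 d[of 0] by (simp add: lin_cong[OF \<tau>, of "P 0" "\<lambda>_. 0"]) (cases \<tau>, simp add: lin_def)
    then have "P' 0 u = 0" if "u \<le> n" for u using that P0 by (simp add: P'')
    then show ?thesis using sym' idem' ann' res' unfolding projection_inv_def by auto
  qed
qed

text \<open>The columns of \<open>P\<close> lie in the common kernel of \<open>A\<close>, which is
  trivial; so \<open>P\<close> is zero, and with it \<open>z - x\<close>, which lies in its
  range.\<close>

lemma projection_inv_unique:
  assumes "projection_inv n A z P x"
    "\<And>y. y 0 = 0 \<Longrightarrow> \<forall>\<tau>\<in>A. lin \<tau> y = 0 \<Longrightarrow> \<forall>u\<le>n. y u = 0" "u \<le> n"
  shows "x u = z u"
proof -
  have "P w v = 0" if "w \<le> n" "v \<le> n" for w v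
    using assms(1) assms(2)[of "\<lambda>w. P w v"] that unfolding projection_inv_def by auto
  then have "(\<Sum>w\<le>n. P u w * (z w - x w)) = 0" using assms(3) by (intro sum.neutral) auto
  then show ?thesis using assms(1,3) unfolding projection_inv_def by auto
qed

section \<open>Violations as sign conditions; existence of an optimum\<close>

text \<open>\<open>(f i - f j)\<^sup>2 - (f i - f k)\<^sup>2\<close> factors as
  \<open>(f k - f j) * (2 * f i - f j - f k)\<close>, half the product of the two forms.\<close>

lemma violates_iff_sgn:
  "violates f (i, j, k) \<longleftrightarrow> \<not> sgn (lin (k, j, j) f) * sgn (lin (i, j, k) f) < 0"
proof -
  have "\<bar>f i - f j\<bar> < \<bar>f i - f k\<bar> \<longleftrightarrow> (f i - f j)\<^sup>2 < (f i - f k)\<^sup>2"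
    by (metis abs_le_square_iff not_le)
  also have "\<dots> \<longleftrightarrow> lin (k, j, j) f * lin (i, j, k) f < 0"
  proof -
    have "lin (k, j, j) f * lin (i, j, k) f = 2 * ((f i - f j)\<^sup>2 - (f i - f k)\<^sup>2)"
      by (simp add: lin_def power2_eq_square algebra_simps)
    then show ?thesis by simp
  qed
  also have "\<dots> \<longleftrightarrow> sgn (lin (k, j, j) f) * sgn (lin (i, j, k) f) < 0"
    by (simp add: sgn_mult[symmetric])
  finally show ?thesis by (simp add: violates_def)
qed

lemma violated_weight_cong:
  assumes "T \<subseteq> points n" "\<And>\<tau>. \<tau> \<in> points n \<Longrightarrow> sgn (lin \<tau> f) = sgn (lin \<tau> g)"
  shows "violated_weight T w f = violated_weight T w g"
proof -
  have "violates f \<tau> = violates g \<tau>" if "\<tau> \<in> T" for \<tau>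
  proof -
    obtain i j k where \<tau>: "\<tau> = (i, j, k)" by (cases \<tau>)
    have "(i, j, k) \<in> points n" "(k, j, j) \<in> points n"
      using that assms(1) \<tau> by (auto simp: points_def)
    then show ?thesis using assms(2) by (simp add: \<tau> violates_iff_sgn)
  qed
  then show ?thesis unfolding violated_weight_def by (metis (mono_tags, lifting) Collect_cong)
qed

text \<open>The maps form an infinite set, but their losses are sums over subsets of
  \<open>T\<close>, so only finitely many values compete.\<close>

lemma optimal_solution_exists:
  assumes "finite T"
  shows "\<exists>f. optimal_solution n T w f"
proof -
  let ?F = "{1..n} \<rightarrow> {0..1::real}"
  have "violated_weight T w ` ?F \<subseteq> sum w ` Pow T" by (auto simp: violated_weight_def)
  then have fin: "finite (violated_weight T w ` ?F)" by (rule finite_subset) (simp add: assms)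
  have "(\<lambda>_. 0) \<in> ?F" by auto
  then have "Min (violated_weight T w ` ?F) \<in> violated_weight T w ` ?F"
    using fin by (intro Min_in) auto
  then obtain f where f: "f \<in> ?F" "violated_weight T w f = Min (violated_weight T w ` ?F)" by auto
  have "violated_weight T w f \<le> violated_weight T w g" if "g \<in> ?F" for g
    unfolding f(2) using fin that by (intro Min_le) auto
  then show ?thesis using f(1) by (auto simp: optimal_solution_def is_arg_min_linorder)
qed

section \<open>A language of bounded loops\<close>

text \<open>
  Programs are written in a small language of bounded loops whose semantics is a total function
  and whose running time has a syntactic bound. \<open>Lv\<close> reads a loop variable, \<open>Raw\<close> an input cell, \<open>Ld\<close>
  and \<open>RLd\<close> an array entry; scalars are arrays used at index \<open>0\<close>. The array \<open>IO\<close> is the initial segment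
  of the real memory, which holds first the weights and finally the output.
  \<open>For x k a b c\<close> executes \<open>c\<close> for all values of \<open>x\<close> below \<open>k + a * n + b * m\<close>, where \<open>m\<close> is the
  number of triples.
\<close>

datatype lvar = U | W | V
datatype nvar = I | J | K | Top | Carry | D | Row
datatype rvar = IO | X | Dir | Proj | Best | Rhs | DD | Step | Wt | BestWt | Total

primrec lcode :: "lvar \<Rightarrow> nat" where "lcode U = 0" | "lcode W = 1" | "lcode V = 2"
primrec ncode :: "nvar \<Rightarrow> nat" where
  "ncode I = 3" | "ncode J = 4" | "ncode K = 5" | "ncode Top = 6" | "ncode Carry = 7" | "ncode D = 8"
| "ncode Row = 9"
primrec rcode :: "rvar \<Rightarrow> nat" where
  "rcode IO = 0" | "rcode X = 1" | "rcode Dir = 2" | "rcode Proj = 3" | "rcode Best = 4"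
| "rcode Rhs = 5" | "rcode DD = 6" | "rcode Step = 7" | "rcode Wt = 8" | "rcode BestWt = 9"
| "rcode Total = 10"

datatype ae = C nat | Lv lvar | Raw ae | Ld nvar ae | Ad ae ae | Sb ae ae
datatype re = RC int | RLd rvar ae | RAd re re | RSb re re | RMu re re | RDi re re
datatype be = Lt ae ae | RLt re re
datatype cmd =
    Sk
  | NS nvar ae ae
  | RS rvar ae re
  | Sq cmd cmd (infixr ";;" 60)
  | Ife be cmd cmd
  | For lvar nat nat nat cmd

type_synonym env = "lvar \<Rightarrow> nat"
type_synonym store = "(nvar \<Rightarrow> nat \<Rightarrow> nat) \<times> (rvar \<Rightarrow> nat \<Rightarrow> real)"

text \<open>
  \<open>hiE\<close> evaluates to \<open>n + 3 * m + 1\<close>. The cells up to this address are left to input and output;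
  the arrays are interleaved above it, entry \<open>i\<close> of the array with code \<open>c < 16\<close> occupying the
  \<open>(c + 16 * i)\<close>-th cell. Truncated subtraction clamps the addresses of \<open>Raw\<close> and \<open>IO\<close> to the lower
  segment, so that the two parts of the memory can never interfere.
\<close>

definition hiE :: nexp where
  "hiE = NAdd (NLoad (NConst 0))
     (NAdd (NLoad (NConst 1)) (NAdd (NLoad (NConst 1)) (NAdd (NLoad (NConst 1)) (NConst 1))))"
definition clampE :: "nexp \<Rightarrow> nexp" where "clampE e = NSub hiE (NSub hiE e)"
definition dbl :: "nexp \<Rightarrow> nexp" where "dbl e = NAdd e e"
text \<open>Four doublings give the factor 16, as the machine has no multiplication of natural
  numbers; \<open>rep\<close> unrolls constant multiples for the same reason.\<close>

definition adr :: "nat \<Rightarrow> nexp \<Rightarrow> nexp" where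
  "adr c e = NAdd hiE (NAdd (NConst (Suc c)) (dbl (dbl (dbl (dbl e)))))"
primrec rep :: "nat \<Rightarrow> nexp \<Rightarrow> nexp" where
  "rep 0 e = NConst 0"
| "rep (Suc k) e = NAdd e (rep k e)"
definition boundE :: "nat \<Rightarrow> nat \<Rightarrow> nat \<Rightarrow> nexp" where
  "boundE k a b = NAdd (NConst k) (NAdd (rep a (NLoad (NConst 0))) (rep b (NLoad (NConst 1))))"

primrec cN :: "ae \<Rightarrow> nexp" where
  "cN (C k) = NConst k"
| "cN (Lv x) = NLoad (adr (lcode x) (NConst 0))"
| "cN (Raw e) = NLoad (clampE (cN e))"
| "cN (Ld x e) = NLoad (adr (ncode x) (cN e))"
| "cN (Ad a b) = NAdd (cN a) (cN b)"
| "cN (Sb a b) = NSub (cN a) (cN b)"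

definition radr :: "rvar \<Rightarrow> nexp \<Rightarrow> nexp" where
  "radr x e = (if x = IO then clampE e else adr (rcode x) e)"

primrec cR :: "re \<Rightarrow> rexp" where
  "cR (RC k) = RConst k"
| "cR (RLd x e) = RLoad (radr x (cN e))"
| "cR (RAd a b) = RAdd (cR a) (cR b)"
| "cR (RSb a b) = RSub (cR a) (cR b)"
| "cR (RMu a b) = RMul (cR a) (cR b)"
| "cR (RDi a b) = RDiv (cR a) (cR b)"

primrec cB :: "be \<Rightarrow> bexp" where
  "cB (Lt a b) = NLess (cN a) (cN b)"
| "cB (RLt a b) = RLess (cR a) (cR b)"

definition lset :: "lvar \<Rightarrow> nexp \<Rightarrow> com" where
  "lset x e = NStore (adr (lcode x) (NConst 0)) e"
definition incr :: "lvar \<Rightarrow> com" where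
  "incr x = lset x (NAdd (cN (Lv x)) (NConst 1))"

primrec comp :: "cmd \<Rightarrow> com" where
  "comp Sk = Skip"
| "comp (NS x i e) = NStore (adr (ncode x) (cN i)) (cN e)"
| "comp (RS x i e) = RStore (radr x (cN i)) (cR e)"
| "comp (c ;; d) = Seq (comp c) (comp d)"
| "comp (Ife b c d) = If (cB b) (comp c) (comp d)"
| "comp (For x k a b c) = Seq
     (While (NLess (cN (Lv x)) (boundE k a b)) (Seq (comp c) (incr x)))
     (lset x (NConst 0))"


section \<open>Scoping, write sets and running-time bounds\<close>

text \<open>Every loop variable has a single cell and a finished loop leaves zero there, so a nested
  loop over the same variable would reset the outer one.\<close>

primrec scoped :: "lvar set \<Rightarrow> cmd \<Rightarrow> bool" where
  "scoped S Sk = True"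
| "scoped S (NS x i e) = True"
| "scoped S (RS x i e) = True"
| "scoped S (c ;; d) = (scoped S c \<and> scoped S d)"
| "scoped S (Ife b c d) = (scoped S c \<and> scoped S d)"
| "scoped S (For x k a b c) = (x \<notin> S \<and> scoped (insert x S) c)"

primrec modN :: "cmd \<Rightarrow> nvar set" where
  "modN Sk = {}"
| "modN (NS x i e) = {x}"
| "modN (RS x i e) = {}"
| "modN (c ;; d) = modN c \<union> modN d"
| "modN (Ife b c d) = modN c \<union> modN d"
| "modN (For x k a b c) = modN c"

primrec modR :: "cmd \<Rightarrow> rvar set" where
  "modR Sk = {}"
| "modR (NS x i e) = {}"
| "modR (RS x i e) = {x}"
| "modR (c ;; d) = modR c \<union> modR d"
| "modR (Ife b c d) = modR c \<union> modR d"
| "modR (For x k a b c) = modR c"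

definition testcost :: "lvar \<Rightarrow> nat \<Rightarrow> nat \<Rightarrow> nat \<Rightarrow> nat" where
  "testcost x k a b = 1 + bcost (NLess (cN (Lv x)) (boundE k a b))"

definition lsetcost :: "lvar \<Rightarrow> nexp \<Rightarrow> nat" where
  "lsetcost x e = 1 + ncost (adr (lcode x) (NConst 0)) + ncost e"

primrec cost :: "nat \<Rightarrow> nat \<Rightarrow> cmd \<Rightarrow> nat" where
  "cost n m Sk = 1"
| "cost n m (NS x i e) = 1 + ncost (adr (ncode x) (cN i)) + ncost (cN e)"
| "cost n m (RS x i e) = 1 + ncost (radr x (cN i)) + rcost (cR e)"
| "cost n m (c ;; d) = 1 + cost n m c + cost n m d"
| "cost n m (Ife b c d) = 1 + bcost (cB b) + max (cost n m c) (cost n m d)"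
| "cost n m (For x k a b c) = 1 + lsetcost x (NConst 0) + testcost x k a b +
     (k + a * n + b * m) *
       (testcost x k a b + 1 + lsetcost x (NAdd (cN (Lv x)) (NConst 1)) + cost n m c)"

text \<open>Every loop counts with degree \<open>3\<close> because there may be \<open>n\<^sup>3\<close> triples.\<close>

primrec deg :: "cmd \<Rightarrow> nat" where
  "deg Sk = 0"
| "deg (NS x i e) = 0"
| "deg (RS x i e) = 0"
| "deg (c ;; d) = deg c + deg d"
| "deg (Ife b c d) = deg c + deg d"
| "deg (For x k a b c) = 3 + deg c"

text \<open>Adding the degrees in sequences and branches is generous, but the final bound tolerates
  every polynomial.\<close>

lemma cost_poly: "\<exists>B. \<forall>n m. m \<le> n ^ 3 \<longrightarrow> cost n m c \<le> B * (n + 1) ^ deg c"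
proof (induction c)
  case (Sq c d)
  then obtain B B' where B: "\<And>n m. m \<le> n ^ 3 \<Longrightarrow> cost n m c \<le> B * (n + 1) ^ deg c"
    and B': "\<And>n m. m \<le> n ^ 3 \<Longrightarrow> cost n m d \<le> B' * (n + 1) ^ deg d" by blast
  have "cost n m (c ;; d) \<le> (1 + B + B') * (n + 1) ^ deg (c ;; d)" if "m \<le> n ^ 3" for n m
  proof -
    have "cost n m c \<le> B * (n + 1) ^ (deg c + deg d)"
      using B[OF that] by (rule order_trans) (intro mult_left_mono power_increasing, auto)
    moreover have "cost n m d \<le> B' * (n + 1) ^ (deg c + deg d)"
      using B'[OF that] by (rule order_trans) (intro mult_left_mono power_increasing, auto)
    moreover have "1 \<le> (n + 1) ^ (deg c + deg d)" by simp
    ultimately show ?thesis unfolding cost.simps deg.simps distrib_right mult_1 by linarith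
  qed
  then show ?case by blast
next
  case (Ife b c d)
  then obtain B B' where B: "\<And>n m. m \<le> n ^ 3 \<Longrightarrow> cost n m c \<le> B * (n + 1) ^ deg c"
    and B': "\<And>n m. m \<le> n ^ 3 \<Longrightarrow> cost n m d \<le> B' * (n + 1) ^ deg d" by blast
  have "cost n m (Ife b c d) \<le> (1 + bcost (cB b) + B + B') * (n + 1) ^ deg (Ife b c d)"
    if "m \<le> n ^ 3" for n m
  proof -
    have "cost n m c \<le> B * (n + 1) ^ (deg c + deg d)"
      using B[OF that] by (rule order_trans) (intro mult_left_mono power_increasing, auto)
    moreover have "cost n m d \<le> B' * (n + 1) ^ (deg c + deg d)"
      using B'[OF that] by (rule order_trans) (intro mult_left_mono power_increasing, auto)
    moreover have "(1 + bcost (cB b)) * 1 \<le> (1 + bcost (cB b)) * (n + 1) ^ (deg c + deg d)"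
      by (intro mult_left_mono) auto
    ultimately show ?thesis unfolding cost.simps deg.simps distrib_right mult_1 by linarith
  qed
  then show ?case by blast
next
  case (For x k a b c)
  then obtain B where B: "\<And>n m. m \<le> n ^ 3 \<Longrightarrow> cost n m c \<le> B * (n + 1) ^ deg c" by blast
  define p where "p = 1 + lsetcost x (NConst 0) + testcost x k a b"
  define q where "q = testcost x k a b + 1 + lsetcost x (NAdd (cN (Lv x)) (NConst 1))"
  have "cost n m (For x k a b c) \<le> (p + (k + a + b) * (q + B)) * (n + 1) ^ deg (For x k a b c)"
    if m: "m \<le> n ^ 3" for n m
  proof -
    let ?N = "(n + 1) ^ 3" and ?M = "(n + 1) ^ deg c"
    have N: "1 \<le> ?N" "n \<le> ?N" "m \<le> ?N"
      using self_le_power[of "n + 1" 3] order_trans[OF m power_mono[of n "n + 1" 3]] by auto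
    have M: "1 \<le> ?M" by simp
    have "k + a * n + b * m \<le> k * ?N + a * ?N + b * ?N"
      using N by (intro add_mono mult_left_mono) auto
    then have 1: "k + a * n + b * m \<le> (k + a + b) * ?N" by (simp add: algebra_simps)
    have "q * 1 + cost n m c \<le> q * ?M + B * ?M"
      using M B[OF m] by (intro add_mono mult_left_mono) auto
    then have 2: "q + cost n m c \<le> (q + B) * ?M" by (simp add: algebra_simps)
    have 3: "p * 1 \<le> p * (?N * ?M)" using N M by (intro mult_left_mono) auto
    have "cost n m (For x k a b c) = p * 1 + (k + a * n + b * m) * (q + cost n m c)"
      by (simp add: p_def q_def)
    also have "\<dots> \<le> p * (?N * ?M) + ((k + a + b) * ?N) * ((q + B) * ?M)"
      using 1 2 3 by (intro add_mono mult_mono) auto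
    also have "\<dots> = (p + (k + a + b) * (q + B)) * (n + 1) ^ deg (For x k a b c)"
      by (simp add: algebra_simps power_add)
    finally show ?thesis .
  qed
  then show ?case by blast
qed (auto intro: exI[of _ "1::nat"])

section \<open>Semantics of the loop language and correctness of compilation\<close>

locale machine =
  fixes n m :: nat and inN :: "nat \<Rightarrow> nat"
  assumes inN_0: "inN 0 = n" and inN_1: "inN (Suc 0) = m"
begin

definition hi :: nat where "hi = n + 3 * m + 1"

abbreviation clamp :: "nat \<Rightarrow> nat" where "clamp i \<equiv> hi - (hi - i)"

primrec av :: "ae \<Rightarrow> env \<Rightarrow> store \<Rightarrow> nat" where
  "av (C k) \<rho> \<sigma> = k"
| "av (Lv x) \<rho> \<sigma> = \<rho> x"
| "av (Raw e) \<rho> \<sigma> = inN (clamp (av e \<rho> \<sigma>))"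
| "av (Ld x e) \<rho> \<sigma> = fst \<sigma> x (av e \<rho> \<sigma>)"
| "av (Ad a b) \<rho> \<sigma> = av a \<rho> \<sigma> + av b \<rho> \<sigma>"
| "av (Sb a b) \<rho> \<sigma> = av a \<rho> \<sigma> - av b \<rho> \<sigma>"

definition ridx :: "rvar \<Rightarrow> nat \<Rightarrow> nat" where
  "ridx x i = (if x = IO then clamp i else i)"

primrec rv :: "re \<Rightarrow> env \<Rightarrow> store \<Rightarrow> real" where
  "rv (RC k) \<rho> \<sigma> = of_int k"
| "rv (RLd x e) \<rho> \<sigma> = snd \<sigma> x (ridx x (av e \<rho> \<sigma>))"
| "rv (RAd a b) \<rho> \<sigma> = rv a \<rho> \<sigma> + rv b \<rho> \<sigma>"
| "rv (RSb a b) \<rho> \<sigma> = rv a \<rho> \<sigma> - rv b \<rho> \<sigma>"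
| "rv (RMu a b) \<rho> \<sigma> = rv a \<rho> \<sigma> * rv b \<rho> \<sigma>"
| "rv (RDi a b) \<rho> \<sigma> = rv a \<rho> \<sigma> / rv b \<rho> \<sigma>"

primrec bv :: "be \<Rightarrow> env \<Rightarrow> store \<Rightarrow> bool" where
  "bv (Lt a b) \<rho> \<sigma> \<longleftrightarrow> av a \<rho> \<sigma> < av b \<rho> \<sigma>"
| "bv (RLt a b) \<rho> \<sigma> \<longleftrightarrow> rv a \<rho> \<sigma> < rv b \<rho> \<sigma>"

primrec run :: "cmd \<Rightarrow> env \<Rightarrow> store \<Rightarrow> store" where
  "run Sk \<rho> \<sigma> = \<sigma>"
| "run (NS x i e) \<rho> \<sigma> = ((fst \<sigma>)(x := (fst \<sigma> x)(av i \<rho> \<sigma> := av e \<rho> \<sigma>)), snd \<sigma>)"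
| "run (RS x i e) \<rho> \<sigma> = (fst \<sigma>, (snd \<sigma>)(x := (snd \<sigma> x)(ridx x (av i \<rho> \<sigma>) := rv e \<rho> \<sigma>)))"
| "run (c ;; d) \<rho> \<sigma> = run d \<rho> (run c \<rho> \<sigma>)"
| "run (Ife b c d) \<rho> \<sigma> = (if bv b \<rho> \<sigma> then run c \<rho> \<sigma> else run d \<rho> \<sigma>)"
| "run (For x k a b c) \<rho> \<sigma> =
     fold (\<lambda>i. run c (\<rho>(x := i))) [0..<k + a * n + b * m] \<sigma>"

lemma run_frame:
  shows run_modN: "x \<notin> modN c \<Longrightarrow> fst (run c \<rho> \<sigma>) x = fst \<sigma> x"
    and run_modR: "y \<notin> modR c \<Longrightarrow> snd (run c \<rho> \<sigma>) y = snd \<sigma> y"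
proof (induction c arbitrary: \<rho> \<sigma>)
  case (For z k a b c)
  case 1
  have "fst (fold (\<lambda>i. run c (\<rho>(z := i))) is \<sigma>) x = fst \<sigma> x" for "is"
    using For 1 by (induction "is" arbitrary: \<sigma>) auto
  then show ?case by simp
next
  case (For z k a b c)
  case 2
  have "snd (fold (\<lambda>i. run c (\<rho>(z := i))) is \<sigma>) y = snd \<sigma> y" for "is"
    using For 2 by (induction "is" arbitrary: \<sigma>) auto
  then show ?case by simp
qed auto

lemma run_modN_empty: "modN c = {} \<Longrightarrow> fst (run c \<rho> \<sigma>) = fst \<sigma>"
  by (rule ext) (simp add: run_modN)

text \<open>The step may assume that arrays outside the write sets of the body still have their
  values from before the loop, so invariants need not repeat them.\<close>

lemma run_For_induct:
  assumes "Inv 0 \<sigma>"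
    and step: "\<And>i \<tau>. i < k + a * n + b * m \<Longrightarrow> Inv i \<tau> \<Longrightarrow>
      (\<And>y. y \<notin> modN c \<Longrightarrow> fst \<tau> y = fst \<sigma> y) \<Longrightarrow>
      (\<And>y. y \<notin> modR c \<Longrightarrow> snd \<tau> y = snd \<sigma> y) \<Longrightarrow>
      Inv (Suc i) (run c (\<rho>(x := i)) \<tau>)"
  shows "Inv (k + a * n + b * m) (run (For x k a b c) \<rho> \<sigma>)"
proof -
  let ?f = "\<lambda>i. fold (\<lambda>i. run c (\<rho>(x := i))) [0..<i] \<sigma>"
  have "Inv i (?f i) \<and> (\<forall>y. y \<notin> modN c \<longrightarrow> fst (?f i) y = fst \<sigma> y) \<and>
      (\<forall>y. y \<notin> modR c \<longrightarrow> snd (?f i) y = snd \<sigma> y)" if "i \<le> k + a * n + b * m" for i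
    using that
  proof (induction i)
    case 0
    then show ?case using assms(1) by simp
  next
    case (Suc i)
    then show ?case using step[of i "?f i"] by (auto simp: run_frame simp del: fun_upd_apply)
  qed
  then show ?thesis by simp
qed

text \<open>\<open>lcode\<close> and \<open>ncode\<close> must be disjoint, as they share the
  natural-number memory; \<open>rcode\<close> names cells of the other memory and may repeat
  them.\<close>

definition rel :: "env \<Rightarrow> store \<Rightarrow> state \<Rightarrow> bool" where
  "rel \<rho> \<sigma> s \<longleftrightarrow>
     (\<forall>i\<le>hi. fst s i = inN i) \<and>
     (\<forall>x i. fst s (Suc (hi + (ncode x + 16 * i))) = fst \<sigma> x i) \<and>
     (\<forall>x. fst s (Suc (hi + lcode x)) = \<rho> x) \<and>
     (\<forall>x i. x \<noteq> IO \<longrightarrow> snd s (Suc (hi + (rcode x + 16 * i))) = snd \<sigma> x i) \<and>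
     (\<forall>i\<le>hi. snd s i = snd \<sigma> IO i)"

lemma lcode_less: "lcode x < 3" by (cases x) auto
lemma ncode_ge: "3 \<le> ncode x" by (cases x) auto
lemma ncode_less: "ncode x < 16" by (cases x) auto
lemma rcode_less: "rcode x < 16" by (cases x) auto
lemma lcode_inj: "lcode x = lcode y \<longleftrightarrow> x = y" by (cases x; cases y) auto
lemma ncode_inj: "ncode x = ncode y \<longleftrightarrow> x = y" by (cases x; cases y) auto
lemma rcode_inj: "rcode x = rcode y \<longleftrightarrow> x = y" by (cases x; cases y) auto

lemma slot_eq:
  fixes c c' i j :: nat
  assumes "c < 16" "c' < 16"
  shows "c + 16 * i = c' + 16 * j \<longleftrightarrow> c = c' \<and> i = j"
  using assms by presburger

lemma hi_ge: "1 \<le> hi" by (simp add: hi_def)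

lemma nval_hiE: "rel \<rho> \<sigma> s \<Longrightarrow> nval hiE s = hi"
  using hi_ge by (simp add: hiE_def rel_def inN_0 inN_1) (simp add: hi_def)

lemma nval_adr: "rel \<rho> \<sigma> s \<Longrightarrow> nval (adr c e) s = Suc (hi + (c + 16 * nval e s))"
  by (simp add: adr_def dbl_def nval_hiE)

lemma nval_clampE: "rel \<rho> \<sigma> s \<Longrightarrow> nval (clampE e) s = clamp (nval e s)"
  by (simp add: clampE_def nval_hiE)

lemma nval_boundE: "rel \<rho> \<sigma> s \<Longrightarrow> nval (boundE k a b) s = k + a * n + b * m"
proof -
  assume "rel \<rho> \<sigma> s"
  then have "fst s 0 = n" "fst s (Suc 0) = m"
    using hi_ge by (auto simp: rel_def inN_0 inN_1)
  moreover have "nval (rep j e) s = j * nval e s" for j e by (induction j) auto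
  ultimately show ?thesis by (simp add: boundE_def)
qed

lemma nval_cN: "rel \<rho> \<sigma> s \<Longrightarrow> nval (cN e) s = av e \<rho> \<sigma>"
proof (induction e)
  case (Raw e)
  then show ?case by (simp add: nval_clampE) (simp add: rel_def)
next
  case (Ld x e)
  then show ?case by (simp add: nval_adr) (simp add: rel_def)
next
  case (Lv x)
  then show ?case by (simp add: nval_adr) (simp add: rel_def)
qed auto

lemma nval_radr:
  "rel \<rho> \<sigma> s \<Longrightarrow> nval (radr x (cN e)) s =
     (if x = IO then clamp (av e \<rho> \<sigma>) else Suc (hi + (rcode x + 16 * av e \<rho> \<sigma>)))"
  by (simp add: radr_def nval_clampE nval_adr nval_cN)

lemma rval_cR: "rel \<rho> \<sigma> s \<Longrightarrow> rval (cR e) s = rv e \<rho> \<sigma>"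
proof (induction e)
  case (RLd x e)
  then show ?case by (simp add: nval_radr ridx_def) (simp add: rel_def)
qed auto

lemma bval_cB: "rel \<rho> \<sigma> s \<Longrightarrow> bval (cB b) s = bv b \<rho> \<sigma>"
  by (cases b) (auto simp: nval_cN rval_cR)

lemma rel_NStore:
  assumes "rel \<rho> \<sigma> s"
  shows "rel \<rho> ((fst \<sigma>)(x := (fst \<sigma> x)(i := v)), snd \<sigma>)
    ((fst s)(Suc (hi + (ncode x + 16 * i)) := v), snd s)"
proof -
  have "ncode y + 16 * j = ncode x + 16 * i \<longleftrightarrow> y = x \<and> j = i" for y j
    using slot_eq[OF ncode_less ncode_less] ncode_inj by simp
  moreover have "lcode y \<noteq> ncode x + 16 * i" for y
    using lcode_less[of y] ncode_ge[of x] by linarith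
  ultimately show ?thesis using assms by (auto simp: rel_def)
qed

lemma rel_RStore:
  assumes "rel \<rho> \<sigma> s"
  shows "rel \<rho> (fst \<sigma>, (snd \<sigma>)(x := (snd \<sigma> x)(ridx x i := v)))
    (fst s, (snd s)((if x = IO then clamp i else Suc (hi + (rcode x + 16 * i))) := v))"
proof -
  have "rcode y + 16 * j = rcode x + 16 * i \<longleftrightarrow> y = x \<and> j = i" for y j
    using slot_eq[OF rcode_less rcode_less] rcode_inj by simp
  moreover have "Suc (hi + j) \<noteq> clamp i" for j by simp
  ultimately show ?thesis using assms by (cases "x = IO") (simp_all add: rel_def ridx_def)
qed

lemma rel_lset:
  assumes "rel \<rho> \<sigma> s"
  shows "rel (\<rho>(x := v)) \<sigma> ((fst s)(Suc (hi + lcode x) := v), snd s)"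
proof -
  have "ncode y + 16 * i \<noteq> lcode x" for y i
    using lcode_less[of x] ncode_ge[of y] by linarith
  then show ?thesis using assms lcode_inj by (auto simp: rel_def)
qed

lemma exec_lset:
  assumes "rel \<rho> \<sigma> s"
  shows "\<exists>s'. exec (lset x e) s (lsetcost x e) s' \<and> rel (\<rho>(x := nval e s)) \<sigma> s'"
proof (intro exI conjI)
  show "exec (lset x e) s (lsetcost x e) ((fst s)(Suc (hi + lcode x) := nval e s), snd s)"
    using exec.NStore[of "adr (lcode x) (NConst 0)" e s]
    by (simp only: lset_def lsetcost_def nval_adr[OF assms] nval.simps mult_0_right add_0_right)
qed (rule rel_lset[OF assms])

text \<open>
  Loop variables out of scope are zero, so that a loop may start without an initialisation.
\<close>

lemma exec_comp:
  assumes "scoped S c" "\<And>x. x \<notin> S \<Longrightarrow> \<rho> x = 0" "rel \<rho> \<sigma> s"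
  shows "\<exists>t s'. exec (comp c) s t s' \<and> t \<le> cost n m c \<and> rel \<rho> (run c \<rho> \<sigma>) s'"
  using assms
proof (induction c arbitrary: S \<rho> \<sigma> s)
  case Sk
  then show ?case
    unfolding comp.simps cost.simps run.simps using exec.Skip[of s] order_refl by blast
next
  case (NS x i e)
  have "exec (comp (NS x i e)) s (cost n m (NS x i e))
      ((fst s)(Suc (hi + (ncode x + 16 * av i \<rho> \<sigma>)) := av e \<rho> \<sigma>), snd s)"
    using exec.NStore[of "adr (ncode x) (cN i)" "cN e" s]
    by (simp only: comp.simps cost.simps nval_adr[OF NS.prems(3)] nval_cN[OF NS.prems(3)])
  moreover have "rel \<rho> (run (NS x i e) \<rho> \<sigma>)
      ((fst s)(Suc (hi + (ncode x + 16 * av i \<rho> \<sigma>)) := av e \<rho> \<sigma>), snd s)"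
    unfolding run.simps by (rule rel_NStore[OF NS.prems(3)])
  ultimately show ?case by (intro exI conjI[OF _ conjI]) (assumption, rule order_refl)
next
  case (RS x i e)
  let ?j = "if x = IO then clamp (av i \<rho> \<sigma>) else Suc (hi + (rcode x + 16 * av i \<rho> \<sigma>))"
  have "exec (comp (RS x i e)) s (cost n m (RS x i e)) (fst s, (snd s)(?j := rv e \<rho> \<sigma>))"
    using exec.RStore[of "radr x (cN i)" "cR e" s]
    by (simp only: comp.simps cost.simps nval_radr[OF RS.prems(3)] rval_cR[OF RS.prems(3)])
  moreover have "rel \<rho> (run (RS x i e) \<rho> \<sigma>) (fst s, (snd s)(?j := rv e \<rho> \<sigma>))"
    unfolding run.simps by (rule rel_RStore[OF RS.prems(3)])
  ultimately show ?case by (intro exI conjI[OF _ conjI]) (assumption, rule order_refl)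
next
  case (Sq c d)
  then obtain t s1 where 1: "exec (comp c) s t s1" "t \<le> cost n m c" "rel \<rho> (run c \<rho> \<sigma>) s1"
    by (metis scoped.simps(4))
  with Sq obtain t' s2 where 2: "exec (comp d) s1 t' s2" "t' \<le> cost n m d"
    "rel \<rho> (run d \<rho> (run c \<rho> \<sigma>)) s2"
    by (metis scoped.simps(4))
  have "1 + t + t' \<le> cost n m (c ;; d)" using 1 2 by simp
  then show ?case
    using exec.Seq[OF 1(1) 2(1)] 2(3) unfolding comp.simps run.simps by blast
next
  case (Ife b c d)
  show ?case
  proof (cases "bv b \<rho> \<sigma>")
    case True
    with Ife obtain t s1 where 1: "exec (comp c) s t s1" "t \<le> cost n m c" "rel \<rho> (run c \<rho> \<sigma>) s1"
      by (metis scoped.simps(5))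
    have "1 + bcost (cB b) + t \<le> cost n m (Ife b c d)" using 1 by simp
    with True show ?thesis
      using exec.IfTrue[of "cB b" s "comp c" t s1] bval_cB[OF Ife.prems(3)] 1
      unfolding comp.simps run.simps by metis
  next
    case False
    with Ife obtain t s1 where 1: "exec (comp d) s t s1" "t \<le> cost n m d" "rel \<rho> (run d \<rho> \<sigma>) s1"
      by (metis scoped.simps(5))
    have "1 + bcost (cB b) + t \<le> cost n m (Ife b c d)" using 1 by simp
    with False show ?thesis
      using exec.IfFalse[of "cB b" s "comp d" t s1] bval_cB[OF Ife.prems(3)] 1
      unfolding comp.simps run.simps by metis
  qed
next
  case (For x k a b c)
  let ?N = "k + a * n + b * m" and ?b = "NLess (cN (Lv x)) (boundE k a b)"
  let ?body = "Seq (comp c) (incr x)"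
  let ?C = "testcost x k a b + 1 + lsetcost x (NAdd (cN (Lv x)) (NConst 1)) + cost n m c"
  \<comment> \<open>\<open>j\<close> counts the remaining iterations, because a while loop unfolds
    at its front.\<close>
  have loop: "\<exists>t s'. exec (While ?b ?body) s t s' \<and> t \<le> testcost x k a b + j * ?C \<and>
      rel (\<rho>(x := ?N)) (fold (\<lambda>i. run c (\<rho>(x := i))) [?N - j..<?N] \<sigma>) s'"
    if "j \<le> ?N" "rel (\<rho>(x := ?N - j)) \<sigma> s" for j \<sigma> s
    using that
  proof (induction j arbitrary: \<sigma> s)
    case 0
    have "\<not> bval ?b s"
      unfolding bval.simps nval_boundE[OF 0(2)] nval_cN[OF 0(2)] by simp
    from exec.WhileFalse[OF this, of ?body] 0 show ?case
      unfolding testcost_def by fastforce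
  next
    case (Suc j)
    let ?i = "?N - Suc j"
    have i: "Suc ?i = ?N - j" using Suc.prems by simp
    have b: "bval ?b s"
      unfolding bval.simps nval_boundE[OF Suc.prems(2)] nval_cN[OF Suc.prems(2)]
      using Suc.prems(1) by simp
    have sc: "scoped (insert x S) c" using For.prems by simp
    have out: "y \<notin> insert x S \<Longrightarrow> (\<rho>(x := ?i)) y = 0" for y using For.prems(2) by simp
    obtain t1 s1 where 1: "exec (comp c) s t1 s1" "t1 \<le> cost n m c"
      "rel (\<rho>(x := ?i)) (run c (\<rho>(x := ?i)) \<sigma>) s1"
      using For.IH[OF sc out Suc.prems(2)] by blast
    have "nval (NAdd (cN (Lv x)) (NConst 1)) s1 = ?N - j"
      unfolding nval.simps nval_cN[OF 1(3)] using i by simp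
    then obtain s2 where 2: "exec (incr x) s1 (lsetcost x (NAdd (cN (Lv x)) (NConst 1))) s2"
      "rel (\<rho>(x := ?N - j)) (run c (\<rho>(x := ?i)) \<sigma>) s2"
      using exec_lset[OF 1(3), of x "NAdd (cN (Lv x)) (NConst 1)"]
      unfolding incr_def fun_upd_upd by auto
    have "j \<le> ?N" using Suc.prems(1) by simp
    from Suc.IH[OF this 2(2)] obtain t3 s3 where 3: "exec (While ?b ?body) s2 t3 s3"
      "t3 \<le> testcost x k a b + j * ?C"
      "rel (\<rho>(x := ?N)) (fold (\<lambda>i. run c (\<rho>(x := i))) [?N - j..<?N] (run c (\<rho>(x := ?i)) \<sigma>)) s3"
      by blast
    have "[?i..<?N] = ?i # [?N - j..<?N]"
      using Suc.prems(1) i upt_conv_Cons[of ?i ?N] by simp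
    then have "rel (\<rho>(x := ?N)) (fold (\<lambda>i. run c (\<rho>(x := i))) [?i..<?N] \<sigma>) s3"
      using 3(3) by simp
    moreover have "1 + bcost ?b + (1 + t1 + lsetcost x (NAdd (cN (Lv x)) (NConst 1))) + t3
        \<le> testcost x k a b + Suc j * ?C"
      using 1(2) 3(2) by (simp add: testcost_def)
    ultimately show ?case
      using exec.WhileTrue[OF b exec.Seq[OF 1(1) 2(1)] 3(1)] by blast
  qed
  have "\<rho>(x := 0) = \<rho>" using For.prems by auto
  then obtain t s1 where 1: "exec (While ?b ?body) s t s1" "t \<le> testcost x k a b + ?N * ?C"
    "rel (\<rho>(x := ?N)) (run (For x k a b c) \<rho> \<sigma>) s1"
    using loop[of ?N \<sigma> s] For.prems(3) by auto
  obtain s2 where 2: "exec (lset x (NConst 0)) s1 (lsetcost x (NConst 0)) s2"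
    "rel \<rho> (run (For x k a b c) \<rho> \<sigma>) s2"
    using exec_lset[OF 1(3), of x "NConst 0"] \<open>\<rho>(x := 0) = \<rho>\<close> by auto
  have "1 + t + lsetcost x (NConst 0) \<le> cost n m (For x k a b c)"
    using 1(2) by simp
  then show ?case
    using exec.Seq[OF 1(1) 2(1)] 2(2) unfolding comp.simps by blast
qed

end

section \<open>Enumeration of the systems\<close>

text \<open>Mixed radices make the digit vectors exactly as many as the systems; a common base
  \<open>n + 1\<close> for all \<open>4 * n\<close> digits would exceed the time bound.\<close>

definition radix :: "nat \<Rightarrow> nat \<Rightarrow> nat" where
  "radix n p = (if p < 2 * n then n + 1 else if p < 3 * n then 2 else 3)"

definition place :: "nat \<Rightarrow> nat \<Rightarrow> nat" where
  "place n k = (\<Prod>p<k. radix n p)"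

text \<open>The position of a digit vector in the enumeration. It serves the analysis; the program
  handles the digits alone.\<close>

definition code :: "nat \<Rightarrow> nat \<Rightarrow> (nat \<Rightarrow> nat) \<Rightarrow> nat" where
  "code n k d = (\<Sum>p<k. d p * place n p)"

definition digits :: "nat \<Rightarrow> nat \<Rightarrow> (nat \<Rightarrow> nat) \<Rightarrow> bool" where
  "digits n k d \<longleftrightarrow> (\<forall>p<k. d p < radix n p)"

lemma place_Suc: "place n (Suc k) = place n k * radix n k"
  by (simp add: place_def)

lemma code_Suc: "code n (Suc k) d = code n k d + d k * place n k"
  by (simp add: code_def)

lemma code_cong: "(\<And>p. p < k \<Longrightarrow> d p = d' p) \<Longrightarrow> code n k d = code n k d'"
  unfolding code_def by (intro sum.cong) auto

lemma code_less: "digits n k d \<Longrightarrow> code n k d < place n k"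
proof (induction k)
  case 0
  then show ?case by (simp add: code_def place_def)
next
  case (Suc k)
  then have "code n k d < place n k" "Suc (d k) \<le> radix n k" by (auto simp: digits_def)
  then have "code n (Suc k) d < Suc (d k) * place n k" by (simp add: code_Suc)
  also have "\<dots> \<le> radix n k * place n k" using \<open>Suc (d k) \<le> radix n k\<close> by (rule mult_right_mono) simp
  finally show ?case by (simp add: place_Suc mult.commute)
qed

lemma code_inj: "digits n k d \<Longrightarrow> digits n k d' \<Longrightarrow> code n k d = code n k d' \<Longrightarrow> p < k \<Longrightarrow> d p = d' p"
proof (induction k)
  case (Suc k)
  have dig: "digits n k d" "digits n k d'" using Suc.prems by (auto simp: digits_def)
  note less = code_less[OF dig(1)] code_less[OF dig(2)]
  have "code n (Suc k) d div place n k = d k" "code n (Suc k) d mod place n k = code n k d"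
    "code n (Suc k) d' div place n k = d' k" "code n (Suc k) d' mod place n k = code n k d'"
    using less by (simp_all add: code_Suc)
  with Suc.prems(3) have "d k = d' k" "code n k d = code n k d'" by metis+
  with Suc.IH[OF dig] Suc.prems(4) show ?case by (auto simp: less_Suc_eq)
qed simp

lemma place_total: "place n (4 * n) = (6 * (n + 1)\<^sup>2) ^ n"
proof -
  have "place n (4 * n) = prod (radix n) {0..<4 * n}" by (simp add: place_def lessThan_atLeast0)
  also have "\<dots> = prod (radix n) {0..<2 * n} * prod (radix n) {2 * n..<3 * n} * prod (radix n) {3 * n..<4 * n}"
    by (simp add: prod.atLeastLessThan_concat)
  also have "prod (radix n) {0..<2 * n} = (n + 1) ^ (2 * n)"
    by (subst prod.cong[OF refl, of _ _ "\<lambda>_. n + 1"]) (auto simp: radix_def)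
  also have "prod (radix n) {2 * n..<3 * n} = 2 ^ n"
    by (subst prod.cong[OF refl, of _ _ "\<lambda>_. 2"]) (auto simp: radix_def)
  also have "prod (radix n) {3 * n..<4 * n} = 3 ^ n"
    by (subst prod.cong[OF refl, of _ _ "\<lambda>_. 3"]) (auto simp: radix_def)
  also have "(n + 1) ^ (2 * n) * 2 ^ n * 3 ^ n = (6 * (n + 1)\<^sup>2) ^ n"
  proof -
    have "(6 * (n + 1)\<^sup>2) ^ n = ((n + 1)\<^sup>2 * 2 * 3) ^ n" by simp
    then show ?thesis by (simp only: power_mult power_mult_distrib)
  qed
  finally show ?thesis .
qed

text \<open>
  The digits \<open>v\<close>, \<open>n + v\<close>, \<open>2 * n + v\<close> and \<open>3 * n + v\<close> describe the equation of the unknown \<open>Suc v\<close>: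
  the two other points, the role of \<open>Suc v\<close>, and the right-hand side increased by \<open>1\<close>.
\<close>

definition decode :: "nat \<Rightarrow> (nat \<Rightarrow> nat) \<Rightarrow> nat \<Rightarrow> triple" where
  "decode n d v = (if d (2 * n + v) = 0 then (Suc v, d v, d (n + v)) else (d v, Suc v, d (n + v)))"

definition rhs :: "nat \<Rightarrow> (nat \<Rightarrow> nat) \<Rightarrow> nat \<Rightarrow> real" where
  "rhs n d v = (if d (3 * n + v) = 0 then -1 else if d (3 * n + v) = 1 then 0 else 1)"

lemma decode_points:
  assumes "digits n (4 * n) d" "v < n"
  shows "decode n d v \<in> points n"
proof -
  have "d p < n + 1" if "p < 2 * n" for p
    using assms that by (auto simp: digits_def radix_def split: if_splits)
  then have "d v \<le> n" "d (n + v) \<le> n" using assms(2) by (simp_all add: less_Suc_eq_le)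
  then show ?thesis using assms(2) by (auto simp: decode_def points_def)
qed

lemma vertex_digits_exist:
  assumes "f 0 = 0"
  shows "\<exists>x d. x 0 = 0 \<and> (\<forall>\<tau>\<in>points n. sgn (lin \<tau> x) = sgn (lin \<tau> f)) \<and> digits n (4 * n) d \<and>
    (\<forall>v<n. lin (decode n d v) x = rhs n d v) \<and>
    (\<forall>y. y 0 = 0 \<longrightarrow> (\<forall>v<n. lin (decode n d v) y = 0) \<longrightarrow> (\<forall>u\<le>n. y u = 0))"
proof -
  obtain x e where x: "x 0 = 0" "\<forall>\<tau>\<in>points n. sgn (lin \<tau> x) = sgn (lin \<tau> f)"
    and e: "\<And>v. v \<in> {1..n} \<Longrightarrow> \<exists>a\<le>n. \<exists>b\<le>n. e v = (v, a, b) \<or> e v = (a, v, b)"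
      "\<And>v. v \<in> {1..n} \<Longrightarrow> lin (e v) x \<in> {-1, 0, 1}"
    and uniq: "\<And>y. y 0 = 0 \<Longrightarrow> \<forall>v\<in>{1..n}. lin (e v) y = 0 \<Longrightarrow> \<forall>u\<le>n. y u = 0"
    using sparse_vertex_exists[of f n, OF assms] by blast
  have "\<exists>a b t s. a \<le> n \<and> b \<le> n \<and> t < (2::nat) \<and> s < (3::nat) \<and>
      e (Suc v) = (if t = 0 then (Suc v, a, b) else (a, Suc v, b)) \<and>
      lin (e (Suc v)) x = (if s = 0 then -1 else if s = 1 then 0 else 1)" if "v < n" for v
  proof -
    have v: "Suc v \<in> {1..n}" using that by simp
    obtain a b where ab: "a \<le> n" "b \<le> n" "e (Suc v) = (Suc v, a, b) \<or> e (Suc v) = (a, Suc v, b)"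
      using e(1)[OF v] by blast
    have "\<exists>t<2::nat. e (Suc v) = (if t = 0 then (Suc v, a, b) else (a, Suc v, b))"
      using ab(3) by (metis one_less_numeral_iff one_neq_zero pos2 semiring_norm(76))
    moreover have "\<exists>s<3::nat. lin (e (Suc v)) x = (if s = 0 then -1 else if s = 1 then 0 else 1)"
    proof -
      consider "lin (e (Suc v)) x = -1" | "lin (e (Suc v)) x = 0" | "lin (e (Suc v)) x = 1"
        using e(2)[OF v] by blast
      then show ?thesis
        by cases (rule exI[of _ 0], simp, rule exI[of _ 1], simp, rule exI[of _ 2], simp)
    qed
    ultimately show ?thesis using ab(1,2) by blast
  qed
  then obtain a b t s where abts: "\<And>v. v < n \<Longrightarrow> a v \<le> n \<and> b v \<le> n \<and> t v < (2::nat) \<and> s v < (3::nat) \<and>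
      e (Suc v) = (if t v = 0 then (Suc v, a v, b v) else (a v, Suc v, b v)) \<and>
      lin (e (Suc v)) x = (if s v = 0 then -1 else if s v = 1 then 0 else 1)" by metis
  define d where "d p = (if p < n then a p else if p < 2 * n then b (p - n)
      else if p < 3 * n then t (p - 2 * n) else s (p - 3 * n))" for p
  have d: "d v = a v" "d (n + v) = b v" "d (2 * n + v) = t v" "d (3 * n + v) = s v" if "v < n" for v
    using that by (simp_all add: d_def)
  have dec: "decode n d v = e (Suc v)" if "v < n" for v
    using abts[OF that] d[OF that] by (simp add: decode_def)
  have "digits n (4 * n) d"
    unfolding digits_def
  proof (intro allI impI)
    fix p assume p: "p < 4 * n"
    consider "p < n" | "n \<le> p" "p < 2 * n" | "2 * n \<le> p" "p < 3 * n" | "3 * n \<le> p" "p < 4 * n"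
      using p by linarith
    then show "d p < radix n p"
    proof cases
      case 1
      then show ?thesis using abts[of p] by (simp add: d_def radix_def)
    next
      case 2
      then show ?thesis using abts[of "p - n"] less_diff_conv2[of n p n] by (simp add: d_def radix_def)
    next
      case 3
      then show ?thesis using abts[of "p - 2 * n"] less_diff_conv2[of "2 * n" p n] by (simp add: d_def radix_def)
    next
      case 4
      then show ?thesis using abts[of "p - 3 * n"] less_diff_conv2[of "3 * n" p n] by (simp add: d_def radix_def)
    qed
  qed
  moreover have "lin (decode n d v) x = rhs n d v" if "v < n" for v
  proof -
    have "lin (e (Suc v)) x = (if s v = 0 then -1 else if s v = 1 then 0 else 1)"
      using abts[OF that] by blast
    then show ?thesis by (simp only: rhs_def dec[OF that] d[OF that])
  qed
  moreover have "\<forall>u\<le>n. y u = 0" if y: "y 0 = 0" "\<forall>v<n. lin (decode n d v) y = 0" for y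
  proof -
    have "lin (e v) y = 0" if "v \<in> {1..n}" for v
    proof -
      have "v - 1 < n" "Suc (v - 1) = v" using that by auto
      then show ?thesis using y(2) dec[of "v - 1"] by metis
    qed
    then show ?thesis using uniq y(1) by blast
  qed
  ultimately show ?thesis using x by blast
qed

text \<open>
  If all entries of \<open>x\<close> are nonpositive then the division by zero yields the zero map.
\<close>

definition normalize :: "nat \<Rightarrow> (nat \<Rightarrow> real) \<Rightarrow> nat \<Rightarrow> real" where
  "normalize n x u = max (x u) 0 / (\<Sum>w\<le>n. max (x w) 0)"

text \<open>Nonnegative numbers are bounded by their sum. As any positive factor keeps the signs,
  the sum is as good a divisor as the maximum.\<close>

lemma normalize_range:
  assumes "u \<le> n"
  shows "0 \<le> normalize n x u" "normalize n x u \<le> 1"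
proof -
  have "max (x u) 0 \<le> (\<Sum>w\<le>n. max (x w) 0)"
    using assms by (intro member_le_sum) auto
  moreover have "0 \<le> max (x u) 0" by simp
  ultimately show "0 \<le> normalize n x u" "normalize n x u \<le> 1"
    unfolding normalize_def by (auto intro!: divide_nonneg_nonneg simp: divide_le_eq_1 order_le_less)
qed

text \<open>A positive sum gives a positive scaling; a zero sum forces all entries to vanish, and
  then both signs are zero.\<close>

lemma sgn_lin_normalize:
  assumes "\<And>u. u \<le> n \<Longrightarrow> 0 \<le> x u" "\<tau> \<in> points n"
  shows "sgn (lin \<tau> (normalize n x)) = sgn (lin \<tau> x)"
proof -
  define S where "S = (\<Sum>w\<le>n. x w)"
  have S: "(\<Sum>w\<le>n. max (x w) 0) = S" unfolding S_def using assms(1) by (intro sum.cong) auto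
  have "lin \<tau> (normalize n x) = lin \<tau> (\<lambda>u. inverse S * x u)"
    using assms(1) by (intro lin_cong[OF assms(2)]) (simp add: normalize_def S S_def divide_inverse max_absorb1)
  also have "\<dots> = inverse S * lin \<tau> x" by (rule lin_scale)
  finally have eq: "lin \<tau> (normalize n x) = inverse S * lin \<tau> x" .
  have "0 \<le> S" using assms(1) by (auto simp: S_def intro!: sum_nonneg)
  show ?thesis
  proof (cases "S = 0")
    case True
    then have "\<forall>w\<in>{..n}. x w = 0"
      using assms(1) by (subst sum_nonneg_eq_0_iff[symmetric]) (auto simp: S_def)
    then have "lin \<tau> x = lin \<tau> (\<lambda>_. 0)" by (intro lin_cong[OF assms(2)]) auto
    then show ?thesis using eq True by (cases \<tau>) (simp add: lin_def)
  next
    case False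
    then show ?thesis using eq \<open>0 \<le> S\<close> by (simp add: sgn_mult)
  qed
qed

section \<open>The program\<close>

abbreviation "nE \<equiv> Raw (C 0)"
abbreviation "ld x \<equiv> Ld x (C 0)"
abbreviation "rld x \<equiv> RLd x (C 0)"
abbreviation "entry u w \<equiv> Ad (Ld Row u) w"

definition linE :: "(ae \<Rightarrow> re) \<Rightarrow> re" where
  "linE r = RSb (RSb (RMu (RC 2) (r (ld I))) (r (ld J))) (r (ld K))"

text \<open>The matrix offsets \<open>u * (n + 1)\<close> are tabulated by repeated addition, as
  indices cannot be multiplied.\<close>

definition row_init :: cmd where
  "row_init = For U 0 1 0 (NS Row (Ad (Lv U) (C 1)) (Ad (Ld Row (Lv U)) (Ad nE (C 1))))"

definition proj_init :: cmd where
  "proj_init =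
     For U 1 1 0 (RS X (Lv U) (RC 0) ;; For W 1 1 0 (RS Proj (entry (Lv U) (Lv W)) (RC 0))) ;;
     For U 0 1 0 (RS Proj (entry (Ad (Lv U) (C 1)) (Ad (Lv U) (C 1))) (RC 1))"

definition fetch :: cmd where
  "fetch =
     Ife (Lt (Ld D (Ad nE (Ad nE (Lv V)))) (C 1))
       (NS I (C 0) (Ad (Lv V) (C 1)) ;; NS J (C 0) (Ld D (Lv V)))
       (NS I (C 0) (Ld D (Lv V)) ;; NS J (C 0) (Ad (Lv V) (C 1))) ;;
     NS K (C 0) (Ld D (Ad nE (Lv V))) ;;
     Ife (Lt (Ld D (Ad nE (Ad nE (Ad nE (Lv V))))) (C 1)) (RS Rhs (C 0) (RC (-1)))
       (Ife (Lt (Ld D (Ad nE (Ad nE (Ad nE (Lv V))))) (C 2)) (RS Rhs (C 0) (RC 0))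
         (RS Rhs (C 0) (RC 1)))"

definition direction :: cmd where
  "direction = For U 1 1 0 (RS Dir (Lv U) (linE (\<lambda>e. RLd Proj (entry (Lv U) e))))"

definition step_size :: cmd where
  "step_size = RS DD (C 0) (linE (RLd Dir)) ;;
     RS Step (C 0) (RDi (RSb (rld Rhs) (linE (RLd X))) (rld DD))"

definition update :: cmd where
  "update = For U 1 1 0 (RS X (Lv U) (RAd (RLd X (Lv U)) (RMu (RLd Dir (Lv U)) (rld Step))) ;;
     For W 1 1 0 (RS Proj (entry (Lv U) (Lv W))
       (RSb (RLd Proj (entry (Lv U) (Lv W)))
         (RDi (RMu (RLd Dir (Lv U)) (RLd Dir (Lv W))) (rld DD)))))"

definition solve :: cmd where
  "solve = proj_init ;; For V 0 1 0 (fetch ;; direction ;; step_size ;; update)"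

definition truncate_neg :: cmd where
  "truncate_neg = RS Total (C 0) (RC 0) ;;
     For U 1 1 0 (Ife (RLt (RLd X (Lv U)) (RC 0)) (RS X (Lv U) (RC 0)) Sk ;;
       RS Total (C 0) (RAd (rld Total) (RLd X (Lv U))))"

definition rescale :: cmd where
  "rescale = For U 1 1 0 (RS X (Lv U) (RDi (RLd X (Lv U)) (rld Total)))"

text \<open>Distances are compared by their squares, since the machine has no absolute
  value.\<close>

definition sqE :: "nvar \<Rightarrow> nvar \<Rightarrow> re" where
  "sqE y z = RMu (RSb (RLd X (ld y)) (RLd X (ld z))) (RSb (RLd X (ld y)) (RLd X (ld z)))"

definition weigh :: cmd where
  "weigh = RS Wt (C 0) (RC 0) ;;
     For U 0 0 1 (
       NS I (C 0) (Raw (Ad (C 2) (Ad (Lv U) (Ad (Lv U) (Lv U))))) ;;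
       NS J (C 0) (Raw (Ad (C 3) (Ad (Lv U) (Ad (Lv U) (Lv U))))) ;;
       NS K (C 0) (Raw (Ad (C 4) (Ad (Lv U) (Ad (Lv U) (Lv U))))) ;;
       Ife (RLt (sqE I J) (sqE I K)) Sk (RS Wt (C 0) (RAd (rld Wt) (RLd IO (Lv U)))))"

definition score :: cmd where
  "score = truncate_neg ;; rescale ;; weigh"

definition keep_best :: cmd where
  "keep_best = Ife (RLt (rld Wt) (rld BestWt))
     (For U 1 1 0 (RS Best (Lv U) (RLd X (Lv U))) ;; RS BestWt (C 0) (rld Wt)) Sk"

text \<open>A mixed-radix counter: \<open>Top\<close> is the largest value of the current digit. The
  loop visits all digits even after the carry is gone, and a carry that survives it marks the end of
  the search.\<close>

definition advance :: cmd where
  "advance = NS Carry (C 0) (C 1) ;;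
     For U 0 4 0 (Ife (Lt (C 0) (ld Carry))
       (Ife (Lt (Lv U) (Ad nE nE)) (NS Top (C 0) nE)
          (Ife (Lt (Lv U) (Ad nE (Ad nE nE))) (NS Top (C 0) (C 1)) (NS Top (C 0) (C 2))) ;;
        Ife (Lt (Ld D (Lv U)) (ld Top))
          (NS D (Lv U) (Ad (Ld D (Lv U)) (C 1)) ;; NS Carry (C 0) (C 0))
          (NS D (Lv U) (C 0)))
       Sk)"

text \<open>\<open>X\<close> and \<open>Best\<close> are zero at first, so the loss computed here is
  that of the map in \<open>Best\<close>, and no infinite initial value is called for. The zero
  digits are the first candidate.\<close>

definition init :: cmd where "init = row_init ;; score ;; RS BestWt (C 0) (rld Wt)"
definition try_candidate :: cmd where "try_candidate = solve ;; score ;; keep_best ;; advance"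
definition write_output :: cmd where "write_output = For U 1 1 0 (RS IO (Lv U) (RLd Best (Lv U)))"
definition running :: be where "running = Lt (ld Carry) (C 1)"

text \<open>The number of candidates is exponential, beyond the linear bounds of \<open>For\<close>,
  so the search is a genuine \<open>While\<close>; its length is bounded through the
  counter.\<close>

definition program :: com where
  "program = Seq (comp init) (Seq (While (cB running) (comp try_candidate)) (comp write_output))"

lemmas mod_simps = row_init_def proj_init_def fetch_def direction_def step_size_def update_def
  solve_def truncate_neg_def rescale_def weigh_def score_def keep_best_def advance_def init_def
  try_candidate_def write_output_def

lemma mult_self_less_iff: "x * x < y * y \<longleftrightarrow> \<bar>x\<bar> < \<bar>y\<bar>" for x y :: real
  by (metis abs_le_square_iff not_le power2_eq_square)

section \<open>Effect of the parts of the program\<close>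

context machine
begin

lemma clamp_le: "i \<le> hi \<Longrightarrow> clamp i = i" by simp

lemma av_nE [simp]: "av nE \<rho> \<sigma> = n" using hi_ge by (simp add: inN_0)

text \<open>Injectivity of \<open>h\<close> protects written values from later iterations. The
  hypothesis on the step allows the expression to read cells of the same array that have not yet
  been reached.\<close>

lemma run_fill:
  fixes k a b :: nat
  defines "N \<equiv> k + a * n + b * m"
  assumes inj: "inj_on h {..<N}"
    and step: "\<And>i \<tau>. i < N \<Longrightarrow> fst \<tau> = fst \<sigma> \<Longrightarrow> (\<And>y. y \<noteq> x \<Longrightarrow> snd \<tau> y = snd \<sigma> y) \<Longrightarrow>
      (\<And>j. j \<notin> h ` {..<i} \<Longrightarrow> snd \<tau> x j = snd \<sigma> x j) \<Longrightarrow>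
      ridx x (av ix (\<rho>(z := i)) \<tau>) = h i \<and> rv e (\<rho>(z := i)) \<tau> = g i"
  shows "u < N \<Longrightarrow> snd (run (For z k a b (RS x ix e)) \<rho> \<sigma>) x (h u) = g u"
    and "j \<notin> h ` {..<N} \<Longrightarrow> snd (run (For z k a b (RS x ix e)) \<rho> \<sigma>) x j = snd \<sigma> x j"
proof -
  let ?Inv = "\<lambda>i \<tau>. i \<le> N \<longrightarrow> (\<forall>u<i. snd \<tau> x (h u) = g u) \<and> (\<forall>j. j \<notin> h ` {..<i} \<longrightarrow> snd \<tau> x j = snd \<sigma> x j)"
  have "?Inv (k + a * n + b * m) (run (For z k a b (RS x ix e)) \<rho> \<sigma>)"
  proof (rule run_For_induct)
    fix i \<tau>
    assume i: "i < k + a * n + b * m" and inv: "?Inv i \<tau>"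
      and fr: "\<And>y. y \<notin> modN (RS x ix e) \<Longrightarrow> fst \<tau> y = fst \<sigma> y"
      "\<And>y. y \<notin> modR (RS x ix e) \<Longrightarrow> snd \<tau> y = snd \<sigma> y"
    have "fst \<tau> = fst \<sigma>" using fr(1) by auto
    then have s: "ridx x (av ix (\<rho>(z := i)) \<tau>) = h i" "rv e (\<rho>(z := i)) \<tau> = g i"
      using step[of i \<tau>] i inv fr(2) by (auto simp: N_def)
    have ne: "h u \<noteq> h i" if "u < i" for u
      using inj_onD[OF inj, of u i] that i by (auto simp: N_def)
    have run: "snd (run (RS x ix e) (\<rho>(z := i)) \<tau>) x = (snd \<tau> x)(h i := g i)"
      by (simp only: run.simps snd_conv fun_upd_same s)
    show "?Inv (Suc i) (run (RS x ix e) (\<rho>(z := i)) \<tau>)"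
      unfolding run using inv i ne by (auto simp: N_def less_Suc_eq lessThan_Suc)
  qed simp
  then show "u < N \<Longrightarrow> snd (run (For z k a b (RS x ix e)) \<rho> \<sigma>) x (h u) = g u"
    and "j \<notin> h ` {..<N} \<Longrightarrow> snd (run (For z k a b (RS x ix e)) \<rho> \<sigma>) x j = snd \<sigma> x j"
    by (auto simp: N_def)
qed

definition rows_ok :: "store \<Rightarrow> bool" where
  "rows_ok \<sigma> \<longleftrightarrow> (\<forall>u\<le>n. fst \<sigma> Row u = u * Suc n)"

definition mat :: "store \<Rightarrow> nat \<Rightarrow> nat \<Rightarrow> real" where
  "mat \<sigma> u w = snd \<sigma> Proj (u * Suc n + w)"

lemma rows_ok_cong: "fst \<sigma> Row = fst \<tau> Row \<Longrightarrow> rows_ok \<sigma> = rows_ok \<tau>"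
  by (simp add: rows_ok_def)

lemma entry_eq_iff:
  assumes "w \<le> n" "w' \<le> n"
  shows "u * Suc n + w = u' * Suc n + w' \<longleftrightarrow> u = u' \<and> w = w'"
proof
  assume eq: "u * Suc n + w = u' * Suc n + w'"
  have "(u * Suc n + w) div Suc n = u" "(u' * Suc n + w') div Suc n = u'"
    using assms by (simp_all only: div_mult_self3 div_less less_Suc_eq_le)
  with eq have "u = u'" by metis
  with eq show "u = u' \<and> w = w'" by simp
qed simp

lemma run_row_init:
  assumes "fst \<sigma> Row 0 = 0"
  shows "rows_ok (run row_init \<rho> \<sigma>)"
proof -
  let ?c = "NS Row (Ad (Lv U) (C 1)) (Ad (Ld Row (Lv U)) (Ad nE (C 1)))"
  have "\<forall>u\<le>0 + 1 * n + 0 * m. fst (run row_init \<rho> \<sigma>) Row u = u * Suc n"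
    unfolding row_init_def
  proof (rule run_For_induct[where Inv = "\<lambda>i \<tau>. \<forall>u\<le>i. fst \<tau> Row u = u * Suc n"])
    fix i and \<tau> :: store assume inv: "\<forall>u\<le>i. fst \<tau> Row u = u * Suc n"
    have "fst (run ?c (\<rho>(U := i)) \<tau>) Row = (fst \<tau> Row)(Suc i := fst \<tau> Row i + Suc n)"
      by (simp del: av.simps(3))
    then show "\<forall>u\<le>Suc i. fst (run ?c (\<rho>(U := i)) \<tau>) Row u = u * Suc n"
      using inv by (simp add: le_Suc_eq)
  qed (simp add: assms)
  then show ?thesis by (simp add: rows_ok_def)
qed

text \<open>A new entry may depend on the old entry at the same place, which is still intact when
  its turn comes; this permits updates in place.\<close>

lemma run_fill_row:
  assumes "rows_ok \<sigma>" "\<rho> U = i" "i \<le> n"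
    and step: "\<And>w \<tau>. w \<le> n \<Longrightarrow> fst \<tau> = fst \<sigma> \<Longrightarrow> (\<And>y. y \<noteq> Proj \<Longrightarrow> snd \<tau> y = snd \<sigma> y) \<Longrightarrow>
      mat \<tau> i w = mat \<sigma> i w \<Longrightarrow> rv e (\<rho>(W := w)) \<tau> = g w"
    and uw: "u \<le> n" "w \<le> n"
  shows "mat (run (For W 1 1 0 (RS Proj (entry (Lv U) (Lv W)) e)) \<rho> \<sigma>) u w =
    (if u = i then g w else mat \<sigma> u w)"
proof -
  let ?h = "\<lambda>w. i * Suc n + w"
  have ne: "i * Suc n + w' \<notin> ?h ` {..<j}" if "j \<le> w'" for j w' using that by auto
  have r: "ridx Proj (av (entry (Lv U) (Lv W)) (\<rho>(W := j)) \<tau>) = ?h j"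
    if "fst \<tau> = fst \<sigma>" for j \<tau>
    using assms(1-3) that by (simp add: ridx_def rows_ok_def)
  have s: "ridx Proj (av (entry (Lv U) (Lv W)) (\<rho>(W := j)) \<tau>) = ?h j \<and> rv e (\<rho>(W := j)) \<tau> = g j"
    if "j < 1 + 1 * n + 0 * m" "fst \<tau> = fst \<sigma>" "\<And>y. y \<noteq> Proj \<Longrightarrow> snd \<tau> y = snd \<sigma> y"
      "\<And>l. l \<notin> ?h ` {..<j} \<Longrightarrow> snd \<tau> Proj l = snd \<sigma> Proj l" for j \<tau>
  proof
    have "mat \<tau> i j = mat \<sigma> i j" unfolding mat_def by (rule that(4)) (rule ne, rule order_refl)
    then show "rv e (\<rho>(W := j)) \<tau> = g j" using step[of j \<tau>] that(1-3) by simp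
  qed (rule r, rule that)
  have inj: "inj_on ?h {..<1 + 1 * n + 0 * m}" by (auto simp: inj_on_def)
  have row: "snd (run (For W 1 1 0 (RS Proj (entry (Lv U) (Lv W)) e)) \<rho> \<sigma>) Proj (?h w) = g w"
    by (rule run_fill(1)[where h = ?h and g = g]) (fact inj, fact s, use uw in simp)
  have rest: "snd (run (For W 1 1 0 (RS Proj (entry (Lv U) (Lv W)) e)) \<rho> \<sigma>) Proj j =
      snd \<sigma> Proj j" if "j \<notin> ?h ` {..<1 + 1 * n + 0 * m}" for j
    by (rule run_fill(2)[where h = ?h and g = g]) (fact inj, fact s, fact that)
  show ?thesis
  proof (cases "u = i")
    case True
    then show ?thesis using row unfolding mat_def by simp
  next
    case False
    then have "u * Suc n + w \<notin> ?h ` {..<1 + 1 * n + 0 * m}"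
      by (auto simp: entry_eq_iff[OF uw(2)] less_Suc_eq_le simp del: mult_Suc_right)
    from rest[OF this] show ?thesis using False unfolding mat_def by simp
  qed
qed

declare run.simps(6) [simp del]

lemma mat_upd:
  assumes "u \<le> n" "w \<le> n" "w' \<le> n" "snd \<tau> Proj = (snd \<sigma> Proj)(u' * Suc n + w' := r)"
  shows "mat \<tau> u w = (if u = u' \<and> w = w' then r else mat \<sigma> u w)"
  using assms entry_eq_iff[OF assms(2,3), of u u'] by (simp add: mat_def del: mult_Suc_right)

lemma run_proj_init:
  assumes "rows_ok \<sigma>"
  shows "u \<le> n \<Longrightarrow> snd (run proj_init \<rho> \<sigma>) X u = 0"
    and "u \<le> n \<Longrightarrow> w \<le> n \<Longrightarrow> mat (run proj_init \<rho> \<sigma>) u w = (if u = w \<and> u \<noteq> 0 then 1 else 0)"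
proof -
  let ?row = "For W 1 1 0 (RS Proj (entry (Lv U) (Lv W)) (RC 0))"
  let ?c1 = "RS X (Lv U) (RC 0) ;; ?row"
  let ?c2 = "RS Proj (entry (Ad (Lv U) (C 1)) (Ad (Lv U) (C 1))) (RC 1)"
  define \<sigma>1 where "\<sigma>1 = run (For U 1 1 0 ?c1) \<rho> \<sigma>"
  have "fst \<sigma>1 Row = fst \<sigma> Row" unfolding \<sigma>1_def by (rule run_modN) simp
  then have rows1: "rows_ok \<sigma>1" using assms rows_ok_cong by blast
  have "(\<forall>u<1 + 1 * n + 0 * m. snd \<sigma>1 X u = 0) \<and>
      (\<forall>u<1 + 1 * n + 0 * m. u \<le> n \<longrightarrow> (\<forall>w\<le>n. mat \<sigma>1 u w = 0))"
    unfolding \<sigma>1_def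
  proof (rule run_For_induct[where Inv = "\<lambda>i \<tau>. (\<forall>u<i. snd \<tau> X u = 0) \<and>
      (\<forall>u<i. u \<le> n \<longrightarrow> (\<forall>w\<le>n. mat \<tau> u w = 0))"])
    fix i and \<tau> :: store
    assume i: "i < 1 + 1 * n + 0 * m" and inv: "(\<forall>u<i. snd \<tau> X u = 0) \<and>
        (\<forall>u<i. u \<le> n \<longrightarrow> (\<forall>w\<le>n. mat \<tau> u w = 0))"
      and fr: "\<And>y. y \<notin> modN ?c1 \<Longrightarrow> fst \<tau> y = fst \<sigma> y"
    define \<tau>1 where "\<tau>1 = run (RS X (Lv U) (RC 0)) (\<rho>(U := i)) \<tau>"
    have x1: "snd \<tau>1 X = (snd \<tau> X)(i := 0)" and m1: "mat \<tau>1 = mat \<tau>" and "fst \<tau>1 Row = fst \<tau> Row"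
      by (simp_all add: \<tau>1_def ridx_def mat_def fun_eq_iff)
    then have rows: "rows_ok \<tau>1" using assms fr[of Row] rows_ok_cong[of \<tau>1 \<sigma>] by simp
    have e: "run ?c1 (\<rho>(U := i)) \<tau> = run ?row (\<rho>(U := i)) \<tau>1" by (simp add: \<tau>1_def)
    have "mat (run ?row (\<rho>(U := i)) \<tau>1) u w = (if u = i then 0 else mat \<tau>1 u w)"
      if "u \<le> n" "w \<le> n" for u w
      by (rule run_fill_row[OF rows]) (use i that in auto)
    moreover have "snd (run ?row (\<rho>(U := i)) \<tau>1) X = snd \<tau>1 X"
      by (rule run_modR) simp
    ultimately show "(\<forall>u<Suc i. snd (run ?c1 (\<rho>(U := i)) \<tau>) X u = 0) \<and>
        (\<forall>u<Suc i. u \<le> n \<longrightarrow> (\<forall>w\<le>n. mat (run ?c1 (\<rho>(U := i)) \<tau>) u w = 0))"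
      unfolding e using inv by (simp add: x1 m1 less_Suc_eq)
  qed simp
  then have X1: "\<And>u. u \<le> n \<Longrightarrow> snd \<sigma>1 X u = 0"
    and M1: "\<And>u w. u \<le> n \<Longrightarrow> w \<le> n \<Longrightarrow> mat \<sigma>1 u w = 0" by simp_all
  define \<sigma>2 where "\<sigma>2 = run (For U 0 1 0 ?c2) \<rho> \<sigma>1"
  have e: "run proj_init \<rho> \<sigma> = \<sigma>2" by (simp add: proj_init_def \<sigma>2_def \<sigma>1_def)
  have X2: "snd \<sigma>2 X = snd \<sigma>1 X" unfolding \<sigma>2_def by (rule run_modR) simp
  have "\<forall>u\<le>n. \<forall>w\<le>n. mat \<sigma>2 u w = (if u = w \<and> u \<noteq> 0 \<and> u \<le> 0 + 1 * n + 0 * m then 1 else 0)"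
    unfolding \<sigma>2_def
  proof (rule run_For_induct[where Inv = "\<lambda>i \<tau>. \<forall>u\<le>n. \<forall>w\<le>n.
      mat \<tau> u w = (if u = w \<and> u \<noteq> 0 \<and> u \<le> i then 1 else 0)"])
    fix i and \<tau> :: store
    assume i: "i < 0 + 1 * n + 0 * m"
      and inv: "\<forall>u\<le>n. \<forall>w\<le>n. mat \<tau> u w = (if u = w \<and> u \<noteq> 0 \<and> u \<le> i then 1 else 0)"
      and fr: "\<And>y. y \<notin> modN ?c2 \<Longrightarrow> fst \<tau> y = fst \<sigma>1 y"
    have row: "fst \<tau> Row (Suc i) = Suc i * Suc n"
      using fr[of Row] rows1 i by (simp add: rows_ok_def)
    have upd: "snd (run ?c2 (\<rho>(U := i)) \<tau>) Proj = (snd \<tau> Proj)(Suc i * Suc n + Suc i := 1)"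
      by (simp add: ridx_def row del: mult_Suc mult_Suc_right)
    show "\<forall>u\<le>n. \<forall>w\<le>n. mat (run ?c2 (\<rho>(U := i)) \<tau>) u w =
        (if u = w \<and> u \<noteq> 0 \<and> u \<le> Suc i then 1 else 0)"
    proof (intro allI impI)
      fix u w assume "u \<le> n" "w \<le> n"
      then show "mat (run ?c2 (\<rho>(U := i)) \<tau>) u w = (if u = w \<and> u \<noteq> 0 \<and> u \<le> Suc i then 1 else 0)"
        using mat_upd[OF _ _ _ upd, of u w] i inv by auto
    qed
  qed (use M1 in auto)
  then have M2: "\<And>u w. u \<le> n \<Longrightarrow> w \<le> n \<Longrightarrow> mat \<sigma>2 u w = (if u = w \<and> u \<noteq> 0 then 1 else 0)"
    by simp
  show "u \<le> n \<Longrightarrow> snd (run proj_init \<rho> \<sigma>) X u = 0" unfolding e X2 by (rule X1)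
  show "u \<le> n \<Longrightarrow> w \<le> n \<Longrightarrow> mat (run proj_init \<rho> \<sigma>) u w = (if u = w \<and> u \<noteq> 0 then 1 else 0)"
    unfolding e by (rule M2)
qed

definition trip :: "store \<Rightarrow> triple" where
  "trip \<sigma> = (fst \<sigma> I 0, fst \<sigma> J 0, fst \<sigma> K 0)"

lemma rv_linE: "x \<noteq> IO \<Longrightarrow> rv (linE (RLd x)) \<rho> \<sigma> = lin (trip \<sigma>) (snd \<sigma> x)"
  by (simp add: linE_def lin_def trip_def ridx_def)

lemma run_fetch:
  shows "trip (run fetch \<rho> \<sigma>) = decode n (fst \<sigma> D) (\<rho> V)"
    and "snd (run fetch \<rho> \<sigma>) Rhs 0 = rhs n (fst \<sigma> D) (\<rho> V)"
proof -
  have "2 * n + \<rho> V = n + (n + \<rho> V)" "3 * n + \<rho> V = n + (n + (n + \<rho> V))" by simp_all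
  note eq = this
  show "trip (run fetch \<rho> \<sigma>) = decode n (fst \<sigma> D) (\<rho> V)"
    unfolding decode_def eq by (simp add: fetch_def trip_def inN_0)
  show "snd (run fetch \<rho> \<sigma>) Rhs 0 = rhs n (fst \<sigma> D) (\<rho> V)"
    unfolding rhs_def eq by (auto simp: fetch_def inN_0 ridx_def)
qed

lemma run_direction:
  assumes "rows_ok \<sigma>" "trip \<sigma> \<in> points n" "u \<le> n"
  shows "snd (run direction \<rho> \<sigma>) Dir u = lin (trip \<sigma>) (mat \<sigma> u)"
  unfolding direction_def
proof (rule run_fill(1)[where h = id and g = "\<lambda>u. lin (trip \<sigma>) (mat \<sigma> u)", unfolded id_apply])
  fix i and \<tau> :: store
  assume i: "i < 1 + 1 * n + 0 * m" and \<tau>: "fst \<tau> = fst \<sigma>" "\<And>y. y \<noteq> Dir \<Longrightarrow> snd \<tau> y = snd \<sigma> y"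
  have "fst \<tau> Row i = i * Suc n" using i \<tau>(1) assms(1) by (simp add: rows_ok_def)
  then show "ridx Dir (av (Lv U) (\<rho>(U := i)) \<tau>) = i \<and>
      rv (linE (\<lambda>e. RLd Proj (entry (Lv U) e))) (\<rho>(U := i)) \<tau> = lin (trip \<sigma>) (mat \<sigma> i)"
    using \<tau>(2)[of Proj] by (simp add: ridx_def linE_def lin_def trip_def mat_def \<tau>(1) del: mult_Suc_right)
qed (use assms in auto)

lemma run_step_size:
  shows "snd (run step_size \<rho> \<sigma>) DD 0 = lin (trip \<sigma>) (snd \<sigma> Dir)"
    and "snd (run step_size \<rho> \<sigma>) Step 0 =
      (snd \<sigma> Rhs 0 - lin (trip \<sigma>) (snd \<sigma> X)) / lin (trip \<sigma>) (snd \<sigma> Dir)"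
  by (simp_all add: step_size_def rv_linE ridx_def trip_def)

text \<open>Overwriting in place is sound: each entry depends on its own old value and on
  \<open>Dir\<close>, \<open>Step\<close> and \<open>DD\<close>, which the loop leaves
  alone.\<close>

lemma run_update:
  assumes "rows_ok \<sigma>"
  shows "u \<le> n \<Longrightarrow> snd (run update \<rho> \<sigma>) X u = snd \<sigma> X u + snd \<sigma> Dir u * snd \<sigma> Step 0"
    and "u \<le> n \<Longrightarrow> w \<le> n \<Longrightarrow>
      mat (run update \<rho> \<sigma>) u w = mat \<sigma> u w - snd \<sigma> Dir u * snd \<sigma> Dir w / snd \<sigma> DD 0"
proof -
  let ?a = "RS X (Lv U) (RAd (RLd X (Lv U)) (RMu (RLd Dir (Lv U)) (rld Step)))"
  let ?e = "RSb (RLd Proj (entry (Lv U) (Lv W))) (RDi (RMu (RLd Dir (Lv U)) (RLd Dir (Lv W))) (rld DD))"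
  let ?row = "For W 1 1 0 (RS Proj (entry (Lv U) (Lv W)) ?e)"
  let ?x = "\<lambda>u. snd \<sigma> X u + snd \<sigma> Dir u * snd \<sigma> Step 0"
  let ?m = "\<lambda>u w. mat \<sigma> u w - snd \<sigma> Dir u * snd \<sigma> Dir w / snd \<sigma> DD 0"
  have "(\<forall>u. snd (run update \<rho> \<sigma>) X u = (if u < 1 + 1 * n + 0 * m then ?x u else snd \<sigma> X u)) \<and>
      (\<forall>u\<le>n. \<forall>w\<le>n. mat (run update \<rho> \<sigma>) u w = (if u < 1 + 1 * n + 0 * m then ?m u w else mat \<sigma> u w))"
    unfolding update_def
  proof (rule run_For_induct[where Inv = "\<lambda>i \<tau>. (\<forall>u. snd \<tau> X u = (if u < i then ?x u else snd \<sigma> X u)) \<and>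
      (\<forall>u\<le>n. \<forall>w\<le>n. mat \<tau> u w = (if u < i then ?m u w else mat \<sigma> u w))"])
    fix i and \<tau> :: store
    assume i: "i < 1 + 1 * n + 0 * m"
      and inv: "(\<forall>u. snd \<tau> X u = (if u < i then ?x u else snd \<sigma> X u)) \<and>
        (\<forall>u\<le>n. \<forall>w\<le>n. mat \<tau> u w = (if u < i then ?m u w else mat \<sigma> u w))"
      and frN: "\<And>y. y \<notin> modN (?a ;; ?row) \<Longrightarrow> fst \<tau> y = fst \<sigma> y"
      and frR: "\<And>y. y \<notin> modR (?a ;; ?row) \<Longrightarrow> snd \<tau> y = snd \<sigma> y"
    define \<tau>1 where "\<tau>1 = run ?a (\<rho>(U := i)) \<tau>"
    have "snd \<tau> Dir = snd \<sigma> Dir" "snd \<tau> DD = snd \<sigma> DD" "snd \<tau> Step = snd \<sigma> Step"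
      using frR by simp_all
    then have x1: "snd \<tau>1 X = (snd \<tau> X)(i := ?x i)" and m1: "mat \<tau>1 = mat \<tau>"
      and fst1: "fst \<tau>1 = fst \<tau>" and d1: "snd \<tau>1 Dir = snd \<sigma> Dir" "snd \<tau>1 DD = snd \<sigma> DD"
      using inv by (simp_all add: \<tau>1_def ridx_def mat_def fun_eq_iff)
    then have rows: "rows_ok \<tau>1" using assms frN[of Row] rows_ok_cong[of \<tau>1 \<sigma>] by simp
    have e: "run (?a ;; ?row) (\<rho>(U := i)) \<tau> = run ?row (\<rho>(U := i)) \<tau>1" by (simp add: \<tau>1_def)
    have "mat (run ?row (\<rho>(U := i)) \<tau>1) u w = (if u = i then ?m i w else mat \<tau>1 u w)"
      if "u \<le> n" "w \<le> n" for u w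
    proof (rule run_fill_row[OF rows, where g = "?m i"])
      fix w' and \<tau>' :: store
      assume w': "w' \<le> n" and \<tau>': "fst \<tau>' = fst \<tau>1" "\<And>y. y \<noteq> Proj \<Longrightarrow> snd \<tau>' y = snd \<tau>1 y"
        "mat \<tau>' i w' = mat \<tau>1 i w'"
      have "mat \<tau>' i w' = mat \<sigma> i w'" using \<tau>'(3) m1 inv w' i by simp
      moreover have "fst \<tau>' Row i = i * Suc n" using \<tau>'(1) rows i by (simp add: rows_ok_def)
      ultimately show "rv ?e ((\<rho>(U := i))(W := w')) \<tau>' = ?m i w'"
        using \<tau>'(2)[of Dir] \<tau>'(2)[of DD] d1 by (simp add: ridx_def mat_def del: mult_Suc_right)
    qed (use i that in auto)
    moreover have "snd (run ?row (\<rho>(U := i)) \<tau>1) X = snd \<tau>1 X"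
      by (rule run_modR) simp
    ultimately show "(\<forall>u. snd (run (?a ;; ?row) (\<rho>(U := i)) \<tau>) X u = (if u < Suc i then ?x u else snd \<sigma> X u)) \<and>
        (\<forall>u\<le>n. \<forall>w\<le>n. mat (run (?a ;; ?row) (\<rho>(U := i)) \<tau>) u w = (if u < Suc i then ?m u w else mat \<sigma> u w))"
      unfolding e using inv by (simp add: x1 m1 less_Suc_eq)
  qed simp
  then show "u \<le> n \<Longrightarrow> snd (run update \<rho> \<sigma>) X u = ?x u"
    and "u \<le> n \<Longrightarrow> w \<le> n \<Longrightarrow> mat (run update \<rho> \<sigma>) u w = ?m u w"
    by simp_all
qed

text \<open>The program does not know \<open>z\<close>; it enters through the right-hand sides,
  which stand for the values of the forms at \<open>z\<close> in the projection step.\<close>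

lemma run_solve:
  assumes rows: "rows_ok \<sigma>" and dig: "digits n (4 * n) (fst \<sigma> D)"
    and z: "z 0 = 0" "\<And>v. v < n \<Longrightarrow> lin (decode n (fst \<sigma> D) v) z = rhs n (fst \<sigma> D) v"
    and uniq: "\<And>y. y 0 = 0 \<Longrightarrow> \<forall>v<n. lin (decode n (fst \<sigma> D) v) y = 0 \<Longrightarrow> \<forall>u\<le>n. y u = 0"
    and u: "u \<le> n"
  shows "snd (run solve \<rho> \<sigma>) X u = z u"
proof -
  let ?c = "fetch ;; direction ;; step_size ;; update"
  let ?d = "decode n (fst \<sigma> D)"
  define \<sigma>1 where "\<sigma>1 = run proj_init \<rho> \<sigma>"
  have \<sigma>1: "fst \<sigma>1 y = fst \<sigma> y" for y
    unfolding \<sigma>1_def by (rule run_modN) (simp add: mod_simps)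
  have e: "run solve \<rho> \<sigma> = run (For V 0 1 0 ?c) \<rho> \<sigma>1" by (simp add: solve_def \<sigma>1_def)
  have "projection_inv n (?d ` {..<0 + 1 * n + 0 * m}) z (mat (run solve \<rho> \<sigma>)) (snd (run solve \<rho> \<sigma>) X)"
    unfolding e
  proof (rule run_For_induct[where Inv = "\<lambda>i \<tau>. projection_inv n (?d ` {..<i}) z (mat \<tau>) (snd \<tau> X)"])
    show "projection_inv n (?d ` {..<0}) z (mat \<sigma>1) (snd \<sigma>1 X)"
      using run_proj_init[OF rows] z(1) by (simp add: \<sigma>1_def projection_inv_init)
  next
    fix i and \<tau> :: store
    assume i: "i < 0 + 1 * n + 0 * m"
      and inv: "projection_inv n (?d ` {..<i}) z (mat \<tau>) (snd \<tau> X)"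
      and fr: "\<And>y. y \<notin> modN ?c \<Longrightarrow> fst \<tau> y = fst \<sigma>1 y"
    have i': "i < n" using i by simp
    let ?r = "\<rho>(V := i)"
    have D: "fst \<tau> D = fst \<sigma> D" and Row: "fst \<tau> Row = fst \<sigma> Row"
      using fr \<sigma>1 by (simp_all add: mod_simps)
    define \<tau>1 where "\<tau>1 = run fetch ?r \<tau>"
    define \<tau>2 where "\<tau>2 = run direction ?r \<tau>1"
    define \<tau>3 where "\<tau>3 = run step_size ?r \<tau>2"
    define \<tau>4 where "\<tau>4 = run update ?r \<tau>3"
    have e4: "run ?c ?r \<tau> = \<tau>4" by (simp add: \<tau>1_def \<tau>2_def \<tau>3_def \<tau>4_def)
    have t1: "trip \<tau>1 = ?d i" "snd \<tau>1 Rhs 0 = rhs n (fst \<sigma> D) i"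
      using run_fetch[of ?r \<tau>] by (simp_all add: \<tau>1_def D)
    have pt: "?d i \<in> points n" by (rule decode_points[OF dig i'])
    have f1: "fst \<tau>1 Row = fst \<sigma> Row" "snd \<tau>1 X = snd \<tau> X" "snd \<tau>1 Proj = snd \<tau> Proj"
      unfolding \<tau>1_def Row[symmetric] by (intro run_frame; simp add: mod_simps)+
    have f2: "fst \<tau>2 = fst \<tau>1" "snd \<tau>2 X = snd \<tau> X" "snd \<tau>2 Proj = snd \<tau> Proj" "snd \<tau>2 Rhs = snd \<tau>1 Rhs"
      unfolding \<tau>2_def f1(2,3)[symmetric] by (rule run_modN_empty run_modR; simp add: mod_simps)+
    have f3: "fst \<tau>3 = fst \<tau>1" "snd \<tau>3 X = snd \<tau> X" "snd \<tau>3 Proj = snd \<tau> Proj" "snd \<tau>3 Dir = snd \<tau>2 Dir"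
      unfolding \<tau>3_def f2(1-3)[symmetric] by (rule run_modN_empty run_modR; simp add: mod_simps)+
    have m: "mat \<tau>1 = mat \<tau>" "mat \<tau>3 = mat \<tau>" by (simp_all add: fun_eq_iff mat_def f1 f3)
    have rows1: "rows_ok \<tau>1" "rows_ok \<tau>3"
      using rows rows_ok_cong[of \<tau>1 \<sigma>] rows_ok_cong[of \<tau>3 \<sigma>] f1(1) f3(1) by simp_all
    have t2: "trip \<tau>2 = ?d i" using t1(1) f2(1) by (simp add: trip_def)
    have dir: "snd \<tau>2 Dir u = lin (?d i) (mat \<tau> u)" if "u \<le> n" for u
      using run_direction[OF rows1(1) _ that, of ?r] pt t1(1) m by (simp add: \<tau>2_def)
    have dd: "snd \<tau>3 DD 0 = lin (?d i) (snd \<tau>2 Dir)"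
      and st: "snd \<tau>3 Step 0 = (lin (?d i) z - lin (?d i) (snd \<tau> X)) / lin (?d i) (snd \<tau>2 Dir)"
      using run_step_size[of ?r \<tau>2] t1(2) t2 f2 z(2)[OF i'] by (simp_all add: \<tau>3_def)
    have "projection_inv n (insert (?d i) (?d ` {..<i})) z (mat \<tau>4) (snd \<tau>4 X)"
    proof (rule projection_inv_step[OF inv pt _ dir])
      show "?d ` {..<i} \<subseteq> points n" using decode_points[OF dig] i' by auto
      show "snd \<tau>4 X u = snd \<tau> X u + snd \<tau>2 Dir u *
          ((lin (?d i) z - lin (?d i) (snd \<tau> X)) / lin (?d i) (snd \<tau>2 Dir))" if "u \<le> n" for u
        using run_update(1)[OF rows1(2) that, of ?r] f3 st by (simp add: \<tau>4_def)
      show "mat \<tau>4 u w = mat \<tau> u w - snd \<tau>2 Dir u * snd \<tau>2 Dir w / lin (?d i) (snd \<tau>2 Dir)"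
        if "u \<le> n" "w \<le> n" for u w
        using run_update(2)[OF rows1(2) that, of ?r] f3 m dd by (simp add: \<tau>4_def)
    qed
    then show "projection_inv n (?d ` {..<Suc i}) z (mat (run ?c ?r \<tau>)) (snd (run ?c ?r \<tau>) X)"
      unfolding e4 by (simp add: lessThan_Suc)
  qed
  then show ?thesis
    by (rule projection_inv_unique[OF _ _ u]) (use uniq in auto)
qed

lemma run_truncate_neg:
  shows "u \<le> n \<Longrightarrow> snd (run truncate_neg \<rho> \<sigma>) X u = max (snd \<sigma> X u) 0"
    and "snd (run truncate_neg \<rho> \<sigma>) Total 0 = (\<Sum>u\<le>n. max (snd \<sigma> X u) 0)"
proof -
  let ?c = "Ife (RLt (RLd X (Lv U)) (RC 0)) (RS X (Lv U) (RC 0)) Sk ;;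
       RS Total (C 0) (RAd (rld Total) (RLd X (Lv U)))"
  let ?g = "\<lambda>u. max (snd \<sigma> X u) 0"
  define \<sigma>1 where "\<sigma>1 = run (RS Total (C 0) (RC 0)) \<rho> \<sigma>"
  have e: "run truncate_neg \<rho> \<sigma> = run (For U 1 1 0 ?c) \<rho> \<sigma>1" by (simp add: truncate_neg_def \<sigma>1_def)
  have "(\<forall>u. snd (run truncate_neg \<rho> \<sigma>) X u = (if u < 1 + 1 * n + 0 * m then ?g u else snd \<sigma> X u)) \<and>
      snd (run truncate_neg \<rho> \<sigma>) Total 0 = (\<Sum>u<1 + 1 * n + 0 * m. ?g u)"
    unfolding e
  proof (rule run_For_induct[where Inv = "\<lambda>i \<tau>. (\<forall>u. snd \<tau> X u = (if u < i then ?g u else snd \<sigma> X u)) \<and>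
      snd \<tau> Total 0 = (\<Sum>u<i. ?g u)"])
    show "(\<forall>u. snd \<sigma>1 X u = (if u < 0 then ?g u else snd \<sigma> X u)) \<and> snd \<sigma>1 Total 0 = (\<Sum>u<0. ?g u)"
      by (simp add: \<sigma>1_def ridx_def)
  next
    fix i and \<tau> :: store
    assume inv: "(\<forall>u. snd \<tau> X u = (if u < i then ?g u else snd \<sigma> X u)) \<and> snd \<tau> Total 0 = (\<Sum>u<i. ?g u)"
    have "snd (run ?c (\<rho>(U := i)) \<tau>) X = (snd \<tau> X)(i := max (snd \<tau> X i) 0)"
      "snd (run ?c (\<rho>(U := i)) \<tau>) Total 0 = snd \<tau> Total 0 + max (snd \<tau> X i) 0"
      by (auto simp: ridx_def max_def fun_eq_iff)
    then show "(\<forall>u. snd (run ?c (\<rho>(U := i)) \<tau>) X u = (if u < Suc i then ?g u else snd \<sigma> X u)) \<and>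
        snd (run ?c (\<rho>(U := i)) \<tau>) Total 0 = (\<Sum>u<Suc i. ?g u)"
      using inv by (simp add: less_Suc_eq)
  qed
  then show "u \<le> n \<Longrightarrow> snd (run truncate_neg \<rho> \<sigma>) X u = max (snd \<sigma> X u) 0"
    and "snd (run truncate_neg \<rho> \<sigma>) Total 0 = (\<Sum>u\<le>n. max (snd \<sigma> X u) 0)"
    by (simp_all add: lessThan_Suc_atMost)
qed

lemma run_rescale:
  assumes "u \<le> n"
  shows "snd (run rescale \<rho> \<sigma>) X u = snd \<sigma> X u / snd \<sigma> Total 0"
  unfolding rescale_def
proof (rule run_fill(1)[where h = id and g = "\<lambda>u. snd \<sigma> X u / snd \<sigma> Total 0", unfolded id_apply])
  fix i and \<tau> :: store
  assume "\<And>y. y \<noteq> X \<Longrightarrow> snd \<tau> y = snd \<sigma> y" "\<And>j. j \<notin> (\<lambda>x. x) ` {..<i} \<Longrightarrow> snd \<tau> X j = snd \<sigma> X j"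
  then show "ridx X (av (Lv U) (\<rho>(U := i)) \<tau>) = i \<and>
      rv (RDi (RLd X (Lv U)) (rld Total)) (\<rho>(U := i)) \<tau> = snd \<sigma> X i / snd \<sigma> Total 0"
    by (simp add: ridx_def)
qed (use assms in auto)

definition input_triple :: "nat \<Rightarrow> triple" where
  "input_triple q = (inN (2 + 3 * q), inN (3 + 3 * q), inN (4 + 3 * q))"

lemma run_weigh:
  "snd (run weigh \<rho> \<sigma>) Wt 0 = (\<Sum>q<m. if violates (snd \<sigma> X) (input_triple q) then snd \<sigma> IO q else 0)"
proof -
  let ?r = "\<lambda>k. Raw (Ad (C k) (Ad (Lv U) (Ad (Lv U) (Lv U))))"
  let ?c = "NS I (C 0) (?r 2) ;; NS J (C 0) (?r 3) ;; NS K (C 0) (?r 4) ;;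
    Ife (RLt (sqE I J) (sqE I K)) Sk (RS Wt (C 0) (RAd (rld Wt) (RLd IO (Lv U))))"
  let ?g = "\<lambda>q. if violates (snd \<sigma> X) (input_triple q) then snd \<sigma> IO q else 0"
  define \<sigma>1 where "\<sigma>1 = run (RS Wt (C 0) (RC 0)) \<rho> \<sigma>"
  have e: "run weigh \<rho> \<sigma> = run (For U 0 0 1 ?c) \<rho> \<sigma>1" by (simp add: weigh_def \<sigma>1_def)
  have "snd (run weigh \<rho> \<sigma>) Wt 0 = sum ?g {..<0 + 0 * n + 1 * m}"
    unfolding e
  proof (rule run_For_induct[where Inv = "\<lambda>i \<tau>. snd \<tau> Wt 0 = sum ?g {..<i}"])
    show "snd \<sigma>1 Wt 0 = sum ?g {..<0}" by (simp add: \<sigma>1_def ridx_def)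
  next
    fix i and \<tau> :: store
    assume i: "i < 0 + 0 * n + 1 * m" and inv: "snd \<tau> Wt 0 = sum ?g {..<i}"
      and fr: "\<And>y. y \<notin> modR ?c \<Longrightarrow> snd \<tau> y = snd \<sigma>1 y"
    let ?\<rho> = "\<rho>(U := i)"
    have XIO: "snd \<tau> X = snd \<sigma> X" "snd \<tau> IO = snd \<sigma> IO" using fr by (simp_all add: \<sigma>1_def)
    \<comment> \<open>The last cell of triple \<open>i\<close> has address \<open>4 + 3 * i\<close>,
      at most \<open>3 * m + 1\<close> and hence within \<open>hi\<close>, so clamping changes
      nothing.\<close>
    have clamp: "clamp (k + (i + (i + i))) = k + 3 * i" if "k \<le> 4" for k
      using i that by (simp add: hi_def)
    define \<tau>1 where "\<tau>1 = run (NS I (C 0) (?r 2) ;; NS J (C 0) (?r 3) ;; NS K (C 0) (?r 4)) ?\<rho> \<tau>"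
    have "fst \<tau>1 I 0 = inN (clamp (2 + (i + (i + i))))" "fst \<tau>1 J 0 = inN (clamp (3 + (i + (i + i))))"
      "fst \<tau>1 K 0 = inN (clamp (4 + (i + (i + i))))" and snd1: "snd \<tau>1 = snd \<tau>"
      by (simp_all add: \<tau>1_def)
    then have trip1: "trip \<tau>1 = input_triple i"
      by (simp only: clamp trip_def input_triple_def)
    have b: "bv (RLt (sqE I J) (sqE I K)) ?\<rho> \<tau>1 \<longleftrightarrow> \<not> violates (snd \<sigma> X) (input_triple i)"
      unfolding trip1[symmetric] trip_def violates_def
      by (simp add: sqE_def ridx_def mult_self_less_iff snd1 XIO)
    have "clamp i = i" using i by (intro clamp_le) (simp add: hi_def)
    then have "snd (run (RS Wt (C 0) (RAd (rld Wt) (RLd IO (Lv U)))) ?\<rho> \<tau>1) Wt 0 =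
        snd \<tau> Wt 0 + snd \<sigma> IO i"
      by (simp add: ridx_def snd1 XIO)
    moreover have "run ?c ?\<rho> \<tau> = run (Ife (RLt (sqE I J) (sqE I K)) Sk
        (RS Wt (C 0) (RAd (rld Wt) (RLd IO (Lv U))))) ?\<rho> \<tau>1"
      by (simp add: \<tau>1_def)
    ultimately have "snd (run ?c ?\<rho> \<tau>) Wt 0 = snd \<tau> Wt 0 + ?g i"
      using b by (simp only: run.simps if_distrib[of "\<lambda>s. snd s Wt 0"] snd1) simp
    then show "snd (run ?c ?\<rho> \<tau>) Wt 0 = sum ?g {..<Suc i}" using inv by simp
  qed
  then show ?thesis by simp
qed

lemma run_score:
  shows "u \<le> n \<Longrightarrow> snd (run score \<rho> \<sigma>) X u = normalize n (snd \<sigma> X) u"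
    and "snd (run score \<rho> \<sigma>) Wt 0 =
      (\<Sum>q<m. if violates (snd (run score \<rho> \<sigma>) X) (input_triple q) then snd \<sigma> IO q else 0)"
proof -
  define \<sigma>1 where "\<sigma>1 = run truncate_neg \<rho> \<sigma>"
  define \<sigma>2 where "\<sigma>2 = run rescale \<rho> \<sigma>1"
  have e: "run score \<rho> \<sigma> = run weigh \<rho> \<sigma>2" by (simp add: score_def \<sigma>1_def \<sigma>2_def)
  have X3: "snd (run weigh \<rho> \<sigma>2) X = snd \<sigma>2 X" by (rule run_modR) (simp add: mod_simps)
  have "snd \<sigma>1 IO = snd \<sigma> IO" unfolding \<sigma>1_def by (rule run_modR) (simp add: mod_simps)
  moreover have "snd \<sigma>2 IO = snd \<sigma>1 IO" unfolding \<sigma>2_def by (rule run_modR) (simp add: mod_simps)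
  ultimately have IO: "snd \<sigma>2 IO = snd \<sigma> IO" by simp
  show "u \<le> n \<Longrightarrow> snd (run score \<rho> \<sigma>) X u = normalize n (snd \<sigma> X) u"
    unfolding e X3 using run_rescale[where \<rho> = \<rho> and \<sigma> = \<sigma>1] run_truncate_neg[where \<rho> = \<rho> and \<sigma> = \<sigma>]
    by (simp add: \<sigma>1_def \<sigma>2_def normalize_def)
  show "snd (run score \<rho> \<sigma>) Wt 0 =
      (\<Sum>q<m. if violates (snd (run score \<rho> \<sigma>) X) (input_triple q) then snd \<sigma> IO q else 0)"
    unfolding e X3 run_weigh IO ..
qed

lemma run_keep_best:
  shows "u \<le> n \<Longrightarrow> snd (run keep_best \<rho> \<sigma>) Best u =
      (if snd \<sigma> Wt 0 < snd \<sigma> BestWt 0 then snd \<sigma> X u else snd \<sigma> Best u)"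
    and "snd (run keep_best \<rho> \<sigma>) BestWt 0 = min (snd \<sigma> BestWt 0) (snd \<sigma> Wt 0)"
proof -
  let ?loop = "For U 1 1 0 (RS Best (Lv U) (RLd X (Lv U)))"
  have "snd (run ?loop \<rho> \<sigma>) Best u = snd \<sigma> X u" if "u \<le> n"
  proof (rule run_fill(1)[where h = id and g = "snd \<sigma> X", unfolded id_apply])
    fix i and \<tau> :: store
    assume "\<And>y. y \<noteq> Best \<Longrightarrow> snd \<tau> y = snd \<sigma> y"
    then show "ridx Best (av (Lv U) (\<rho>(U := i)) \<tau>) = i \<and> rv (RLd X (Lv U)) (\<rho>(U := i)) \<tau> = snd \<sigma> X i"
      by (simp add: ridx_def)
  qed (use that in auto)
  moreover have "snd (run ?loop \<rho> \<sigma>) Wt = snd \<sigma> Wt" by (rule run_modR) simp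
  moreover have "run keep_best \<rho> \<sigma> = (if snd \<sigma> Wt 0 < snd \<sigma> BestWt 0
      then run (RS BestWt (C 0) (rld Wt)) \<rho> (run ?loop \<rho> \<sigma>) else \<sigma>)"
    by (simp add: keep_best_def ridx_def)
  ultimately show "u \<le> n \<Longrightarrow> snd (run keep_best \<rho> \<sigma>) Best u =
      (if snd \<sigma> Wt 0 < snd \<sigma> BestWt 0 then snd \<sigma> X u else snd \<sigma> Best u)"
    and "snd (run keep_best \<rho> \<sigma>) BestWt 0 = min (snd \<sigma> BestWt 0) (snd \<sigma> Wt 0)"
    by (simp_all add: ridx_def del: run.simps(6))
qed

lemma run_advance:
  assumes dig: "digits n (4 * n) (fst \<sigma> D)"
  shows "digits n (4 * n) (fst (run advance \<rho> \<sigma>) D)" (is ?dig)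
    and "fst (run advance \<rho> \<sigma>) Carry 0 \<le> 1" (is ?le)
    and "code n (4 * n) (fst (run advance \<rho> \<sigma>) D) +
      fst (run advance \<rho> \<sigma>) Carry 0 * place n (4 * n) = code n (4 * n) (fst \<sigma> D) + 1" (is ?code)
proof -
  let ?c = "Ife (Lt (C 0) (ld Carry))
       (Ife (Lt (Lv U) (Ad nE nE)) (NS Top (C 0) nE)
          (Ife (Lt (Lv U) (Ad nE (Ad nE nE))) (NS Top (C 0) (C 1)) (NS Top (C 0) (C 2))) ;;
        Ife (Lt (Ld D (Lv U)) (ld Top))
          (NS D (Lv U) (Ad (Ld D (Lv U)) (C 1)) ;; NS Carry (C 0) (C 0))
          (NS D (Lv U) (C 0)))
       Sk"
  define \<sigma>1 where "\<sigma>1 = run (NS Carry (C 0) (C 1)) \<rho> \<sigma>"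
  have e: "run advance \<rho> \<sigma> = run (For U 0 4 0 ?c) \<rho> \<sigma>1" by (simp add: advance_def \<sigma>1_def)
  \<comment> \<open>The digits below \<open>i\<close>, with the carry weighted by
    \<open>place n i\<close>, exceed their old value by one, while the digits from \<open>i\<close>
    on are still old.\<close>
  define Inv where "Inv i \<tau> \<longleftrightarrow> digits n (4 * n) (fst \<tau> D) \<and> fst \<tau> Carry 0 \<le> 1 \<and>
    (\<forall>p\<ge>i. fst \<tau> D p = fst \<sigma> D p) \<and>
    code n i (fst \<tau> D) + fst \<tau> Carry 0 * place n i = code n i (fst \<sigma> D) + 1" for i and \<tau> :: store
  have "Inv (0 + 4 * n + 0 * m) (run advance \<rho> \<sigma>)"
    unfolding e
  proof (rule run_For_induct[where Inv = Inv])
    show "Inv 0 \<sigma>1" using dig by (simp add: Inv_def \<sigma>1_def code_def place_def)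
  next
    fix i and \<tau> :: store
    assume i: "i < 0 + 4 * n + 0 * m" and inv: "Inv i \<tau>"
    define \<tau>' where "\<tau>' = run ?c (\<rho>(U := i)) \<tau>"
    let ?d = "fst \<tau> D"
    have lt: "?d i < radix n i" and same: "?d i = fst \<sigma> D i"
      using inv i by (auto simp: Inv_def digits_def)
    have D': "fst \<tau>' D = (if fst \<tau> Carry 0 = 0 then ?d else if Suc (?d i) < radix n i
        then ?d(i := Suc (?d i)) else ?d(i := 0))"
      and C': "fst \<tau>' Carry 0 = (if Suc (?d i) < radix n i then 0 else fst \<tau> Carry 0)"
      by (auto simp: \<tau>'_def inN_0 radix_def)
    have below: "code n i (?d(i := v)) = code n i ?d" for v by (rule code_cong) simp
    consider (no) "fst \<tau> Carry 0 = 0" | (inc) "fst \<tau> Carry 0 = 1" "Suc (?d i) < radix n i"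
      | (wrap) "fst \<tau> Carry 0 = 1" "Suc (?d i) = radix n i"
      using inv lt by (fastforce simp: Inv_def)
    then have "Inv (Suc i) \<tau>'"
    proof cases
      case no
      then show ?thesis using inv D' C' same by (auto simp: Inv_def code_Suc)
    next
      case inc
      then show ?thesis using inv D' C' same below[of "Suc (?d i)"]
        by (auto simp: Inv_def code_Suc digits_def)
    next
      case wrap
      have "place n (Suc i) = place n i + ?d i * place n i"
        unfolding place_Suc wrap(2)[symmetric] by simp
      then show ?thesis using wrap inv D' C' same below[of 0] lt
        by (auto simp: Inv_def code_Suc digits_def)
    qed
    then show "Inv (Suc i) (run ?c (\<rho>(U := i)) \<tau>)" unfolding \<tau>'_def .
  qed
  then show ?dig ?le ?code unfolding Inv_def by simp_all
qed

lemma run_write_output: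
  assumes "u \<le> n"
  shows "snd (run write_output \<rho> \<sigma>) IO u = snd \<sigma> Best u"
  unfolding write_output_def
proof (rule run_fill(1)[where h = id and g = "snd \<sigma> Best", unfolded id_apply])
  fix i and \<tau> :: store
  assume i: "i < 1 + 1 * n + 0 * m" and "\<And>y. y \<noteq> IO \<Longrightarrow> snd \<tau> y = snd \<sigma> y"
  moreover have "clamp i = i" using i by (intro clamp_le) (simp add: hi_def)
  ultimately show "ridx IO (av (Lv U) (\<rho>(U := i)) \<tau>) = i \<and> rv (RLd Best (Lv U)) (\<rho>(U := i)) \<tau> = snd \<sigma> Best i"
    by (simp add: ridx_def)
qed (use assms in auto)

end

lemma normalize_cong: "(\<And>u. u \<le> n \<Longrightarrow> x u = y u) \<Longrightarrow> u \<le> n \<Longrightarrow> normalize n x u = normalize n y u"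
  by (simp add: normalize_def)

lemma violates_cong:
  assumes "\<tau> \<in> points n" "\<And>u. u \<le> n \<Longrightarrow> x u = y u"
  shows "violates x \<tau> = violates y \<tau>"
  using assms by (cases \<tau>) (auto simp: violates_def points_def)

section \<open>The search loop\<close>

text \<open>
  The candidate with digits \<open>d\<close> stands for an optimal solution: the invariant needs no
  knowledge of the other candidates beyond their being admissible maps.
\<close>

locale wlloc_machine = machine +
  fixes wt :: "nat \<Rightarrow> real"
  assumes input_points: "q < m \<Longrightarrow> input_triple q \<in> points n"
begin

definition loss :: "(nat \<Rightarrow> real) \<Rightarrow> real" where
  "loss x = (\<Sum>q<m. if violates x (input_triple q) then wt q else 0)"

lemma loss_cong:
  assumes "\<And>u. u \<le> n \<Longrightarrow> x u = y u"
  shows "loss x = loss y"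
proof -
  have "violates x (input_triple q) = violates y (input_triple q)" if "q < m" for q
    by (rule violates_cong[OF input_points[OF that]]) (rule assms)
  then show ?thesis unfolding loss_def by (intro sum.cong) auto
qed

text \<open>\<open>j\<close> counts the candidates already tried. The carry contributes to it
  because the digits wrap to zero after the last candidate. The bound \<open>b\<close> is due once
  the distinguished vector \<open>d\<close> has had its turn.\<close>

definition loop_inv :: "(nat \<Rightarrow> nat) \<Rightarrow> real \<Rightarrow> nat \<Rightarrow> store \<Rightarrow> bool" where
  "loop_inv d b j \<sigma> \<longleftrightarrow> rows_ok \<sigma> \<and> digits n (4 * n) (fst \<sigma> D) \<and>
     code n (4 * n) (fst \<sigma> D) + fst \<sigma> Carry 0 * place n (4 * n) = j \<and>
     (\<forall>q<m. snd \<sigma> IO q = wt q) \<and> (\<forall>u\<le>n. snd \<sigma> Best u \<in> {0..1}) \<and>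
     snd \<sigma> BestWt 0 = loss (snd \<sigma> Best) \<and> (code n (4 * n) d < j \<longrightarrow> snd \<sigma> BestWt 0 \<le> b)"

lemma run_score_loss:
  assumes "\<forall>q<m. snd \<sigma> IO q = wt q"
  shows "snd (run score \<rho> \<sigma>) Wt 0 = loss (normalize n (snd \<sigma> X))"
proof -
  have "snd (run score \<rho> \<sigma>) Wt 0 = loss (snd (run score \<rho> \<sigma>) X)"
    unfolding run_score(2) loss_def using assms by (intro sum.cong) auto
  also have "\<dots> = loss (normalize n (snd \<sigma> X))" by (rule loss_cong) (rule run_score(1))
  finally show ?thesis .
qed

lemma loop_inv_init:
  assumes "\<forall>q<m. snd \<sigma> IO q = wt q"
    and zero: "\<And>x i. fst \<sigma> x i = 0" "\<And>x i. x \<noteq> IO \<Longrightarrow> snd \<sigma> x i = 0"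
  shows "loop_inv d b 0 (run init \<rho> \<sigma>)"
proof -
  define \<sigma>1 where "\<sigma>1 = run row_init \<rho> \<sigma>"
  define \<sigma>2 where "\<sigma>2 = run score \<rho> \<sigma>1"
  have e: "run init \<rho> \<sigma> = run (RS BestWt (C 0) (rld Wt)) \<rho> \<sigma>2"
    by (simp add: init_def \<sigma>1_def \<sigma>2_def)
  have s1: "snd \<sigma>1 x = snd \<sigma> x" for x unfolding \<sigma>1_def by (rule run_modR) (simp add: mod_simps)
  have rows: "rows_ok \<sigma>1" unfolding \<sigma>1_def by (rule run_row_init) (rule zero)
  have f2: "fst \<sigma>2 Row = fst \<sigma>1 Row" "fst \<sigma>2 D = fst \<sigma>1 D" "fst \<sigma>2 Carry = fst \<sigma>1 Carry"
    unfolding \<sigma>2_def by (rule run_modN; simp add: mod_simps)+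
  have f1: "fst \<sigma>1 D = fst \<sigma> D" "fst \<sigma>1 Carry = fst \<sigma> Carry"
    unfolding \<sigma>1_def by (rule run_modN; simp add: mod_simps)+
  have IO: "snd \<sigma>2 IO = snd \<sigma>1 IO" and Best: "snd \<sigma>2 Best = snd \<sigma>1 Best"
    unfolding \<sigma>2_def by (rule run_modR; simp add: mod_simps)+
  have "snd \<sigma>2 Wt 0 = loss (normalize n (snd \<sigma>1 X))"
    unfolding \<sigma>2_def by (rule run_score_loss) (simp add: s1 assms(1))
  also have "\<dots> = loss (snd \<sigma>2 Best)"
    by (rule loss_cong) (simp add: normalize_def Best s1 zero(2))
  finally have "snd \<sigma>2 Wt 0 = loss (snd \<sigma>2 Best)" .
  moreover have "rows_ok \<sigma>2" using rows rows_ok_cong[OF f2(1)] by simp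
  ultimately show ?thesis
    unfolding e loop_inv_def
    by (simp add: rows_ok_def ridx_def f2 f1 zero IO Best s1 assms(1) digits_def radix_def code_def)
qed

text \<open>The outcome of \<open>solve\<close> matters in the round of \<open>d\<close> alone; in
  every other round it suffices that normalization puts any vector into the unit interval and that
  \<open>BestWt\<close> never increases.\<close>

lemma loop_inv_step:
  assumes d: "digits n (4 * n) d"
    and z: "z 0 = 0" "\<And>v. v < n \<Longrightarrow> lin (decode n d v) z = rhs n d v"
    and uniq: "\<And>y. y 0 = 0 \<Longrightarrow> \<forall>v<n. lin (decode n d v) y = 0 \<Longrightarrow> \<forall>u\<le>n. y u = 0"
    and inv: "loop_inv d (loss (normalize n z)) j \<sigma>" and j: "j < place n (4 * n)"
  shows "loop_inv d (loss (normalize n z)) (Suc j) (run try_candidate \<rho> \<sigma>)"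
proof -
  define \<sigma>1 where "\<sigma>1 = run solve \<rho> \<sigma>"
  define \<sigma>2 where "\<sigma>2 = run score \<rho> \<sigma>1"
  define \<sigma>3 where "\<sigma>3 = run keep_best \<rho> \<sigma>2"
  define \<sigma>4 where "\<sigma>4 = run advance \<rho> \<sigma>3"
  have e: "run try_candidate \<rho> \<sigma> = \<sigma>4"
    by (simp add: try_candidate_def \<sigma>1_def \<sigma>2_def \<sigma>3_def \<sigma>4_def)
  have rows: "rows_ok \<sigma>" and dig: "digits n (4 * n) (fst \<sigma> D)"
    and code: "code n (4 * n) (fst \<sigma> D) = j"
    and IO: "\<forall>q<m. snd \<sigma> IO q = wt q" and Best: "\<forall>u\<le>n. snd \<sigma> Best u \<in> {0..1}"
    and BestWt: "snd \<sigma> BestWt 0 = loss (snd \<sigma> Best)"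
    and le: "code n (4 * n) d < j \<Longrightarrow> snd \<sigma> BestWt 0 \<le> loss (normalize n z)"
    using inv j unfolding loop_inv_def by (cases "fst \<sigma> Carry 0"; simp)+
  have f1: "snd \<sigma>1 IO = snd \<sigma> IO" "snd \<sigma>1 Best = snd \<sigma> Best" "snd \<sigma>1 BestWt = snd \<sigma> BestWt"
    unfolding \<sigma>1_def by (rule run_modR; simp add: mod_simps)+
  have f2: "snd \<sigma>2 IO = snd \<sigma>1 IO" "snd \<sigma>2 Best = snd \<sigma>1 Best" "snd \<sigma>2 BestWt = snd \<sigma>1 BestWt"
    unfolding \<sigma>2_def by (rule run_modR; simp add: mod_simps)+
  have f3: "snd \<sigma>3 IO = snd \<sigma>2 IO"
    unfolding \<sigma>3_def by (rule run_modR; simp add: mod_simps)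
  have f4: "snd \<sigma>4 IO = snd \<sigma>3 IO" "snd \<sigma>4 Best = snd \<sigma>3 Best" "snd \<sigma>4 BestWt = snd \<sigma>3 BestWt"
    unfolding \<sigma>4_def by (rule run_modR; simp add: mod_simps)+
  have D3: "fst \<sigma>3 D = fst \<sigma> D"
  proof -
    have "fst \<sigma>3 D = fst \<sigma>2 D" unfolding \<sigma>3_def by (rule run_modN) (simp add: mod_simps)
    also have "\<dots> = fst \<sigma>1 D" unfolding \<sigma>2_def by (rule run_modN) (simp add: mod_simps)
    also have "\<dots> = fst \<sigma> D" unfolding \<sigma>1_def by (rule run_modN) (simp add: mod_simps)
    finally show ?thesis .
  qed
  have "fst \<sigma>4 Row = fst \<sigma> Row"
    unfolding e[symmetric] by (rule run_modN) (simp add: mod_simps)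
  then have rows4: "rows_ok \<sigma>4" using rows rows_ok_cong by blast
  have X2: "snd \<sigma>2 X u = normalize n (snd \<sigma>1 X) u" if "u \<le> n" for u
    unfolding \<sigma>2_def using that by (rule run_score(1))
  have Wt2: "snd \<sigma>2 Wt 0 = loss (normalize n (snd \<sigma>1 X))"
    unfolding \<sigma>2_def by (rule run_score_loss) (simp add: f1 IO)
  have B3: "snd \<sigma>3 Best u = (if snd \<sigma>2 Wt 0 < snd \<sigma> BestWt 0 then snd \<sigma>2 X u else snd \<sigma> Best u)"
    if "u \<le> n" for u
    using run_keep_best(1)[OF that, of \<rho> \<sigma>2] by (simp add: \<sigma>3_def f2 f1)
  have BW3: "snd \<sigma>3 BestWt 0 = min (snd \<sigma> BestWt 0) (snd \<sigma>2 Wt 0)"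
    using run_keep_best(2)[of \<rho> \<sigma>2] by (simp add: \<sigma>3_def f2 f1)
  have "loss (snd \<sigma>3 Best) =
      (if snd \<sigma>2 Wt 0 < snd \<sigma> BestWt 0 then loss (normalize n (snd \<sigma>1 X)) else loss (snd \<sigma> Best))"
    using B3 X2 by (auto intro!: loss_cong)
  then have BW: "snd \<sigma>3 BestWt 0 = loss (snd \<sigma>3 Best)" using BW3 Wt2 BestWt by simp
  have range: "\<forall>u\<le>n. snd \<sigma>3 Best u \<in> {0..1}" using B3 X2 Best normalize_range[of _ n] by simp
  have "snd \<sigma>3 BestWt 0 \<le> loss (normalize n z)" if "code n (4 * n) d < Suc j"
  proof (cases "code n (4 * n) d < j")
    case True
    then show ?thesis using le BW3 by simp
  next
    case False
    \<comment> \<open>This is the round of \<open>d\<close>: equal codes mean equal digits, hence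
      the system with solution \<open>z\<close>.\<close>
    then have "code n (4 * n) (fst \<sigma> D) = code n (4 * n) d" using that code by simp
    then have eq: "fst \<sigma> D p = d p" if "p < 4 * n" for p using code_inj[OF dig d] that by blast
    have dec: "decode n (fst \<sigma> D) v = decode n d v" "rhs n (fst \<sigma> D) v = rhs n d v" if "v < n" for v
      using that eq by (simp_all add: decode_def rhs_def)
    have "snd \<sigma>1 X u = z u" if "u \<le> n" for u
      unfolding \<sigma>1_def by (rule run_solve[where z = z, OF rows dig z(1)]) (use z(2) uniq dec that in auto)
    then have "loss (normalize n (snd \<sigma>1 X)) = loss (normalize n z)"
      by (intro loss_cong normalize_cong)
    then show ?thesis using BW3 Wt2 by simp
  qed
  moreover have "digits n (4 * n) (fst \<sigma>4 D)"
    "code n (4 * n) (fst \<sigma>4 D) + fst \<sigma>4 Carry 0 * place n (4 * n) = Suc j"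
    using run_advance(1,3)[of \<sigma>3 \<rho>] dig code by (simp_all add: \<sigma>4_def D3)
  ultimately show ?thesis
    unfolding e loop_inv_def using rows4 range BW IO by (simp add: f4 f3 f2 f1)
qed

lemma loop_inv_running:
  assumes "loop_inv d b j \<sigma>"
  shows "bv running \<rho> \<sigma> \<longleftrightarrow> j < place n (4 * n)"
proof -
  have "code n (4 * n) (fst \<sigma> D) < place n (4 * n)"
    and j: "code n (4 * n) (fst \<sigma> D) + fst \<sigma> Carry 0 * place n (4 * n) = j"
    using assms code_less by (auto simp: loop_inv_def)
  moreover have "bv running \<rho> \<sigma> \<longleftrightarrow> fst \<sigma> Carry 0 = 0" by (simp add: running_def)
  ultimately show ?thesis by (cases "fst \<sigma> Carry 0") auto
qed

text \<open>\<open>k\<close> candidates remain; the failing test at the end is charged as a full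
  round, hence \<open>k + 1\<close>.\<close>

lemma exec_loop:
  assumes step: "\<And>j \<sigma>. loop_inv d b j \<sigma> \<Longrightarrow> j < place n (4 * n) \<Longrightarrow>
      loop_inv d b (Suc j) (run try_candidate (\<lambda>_. 0) \<sigma>)"
    and "j + k = place n (4 * n)" "loop_inv d b j \<sigma>" "rel (\<lambda>_. 0) \<sigma> s"
  shows "\<exists>t s' \<sigma>'. exec (While (cB running) (comp try_candidate)) s t s' \<and>
    t \<le> (k + 1) * (1 + bcost (cB running) + cost n m try_candidate) \<and>
    rel (\<lambda>_. 0) \<sigma>' s' \<and> loop_inv d b (place n (4 * n)) \<sigma>'"
  using assms(2-4)
proof (induction k arbitrary: j \<sigma> s)
  case 0
  have "\<not> bval (cB running) s"
    using bval_cB[OF 0(3)] loop_inv_running[OF 0(2)] 0(1) by simp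
  from exec.WhileFalse[OF this] 0 show ?case by fastforce
next
  case (Suc k)
  have lt: "j < place n (4 * n)" using Suc.prems(1) by simp
  have b: "bval (cB running) s"
    using bval_cB[OF Suc.prems(3)] loop_inv_running[OF Suc.prems(2)] lt by simp
  have "scoped {} try_candidate" by (simp add: mod_simps)
  from exec_comp[OF this _ Suc.prems(3)] obtain t1 s1 where 1: "exec (comp try_candidate) s t1 s1"
    "t1 \<le> cost n m try_candidate" "rel (\<lambda>_. 0) (run try_candidate (\<lambda>_. 0) \<sigma>) s1" by blast
  have "Suc j + k = place n (4 * n)" using Suc.prems(1) by simp
  from Suc.IH[OF this step[OF Suc.prems(2) lt] 1(3)] obtain t2 s2 \<sigma>2 where
    2: "exec (While (cB running) (comp try_candidate)) s1 t2 s2"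
    "t2 \<le> (k + 1) * (1 + bcost (cB running) + cost n m try_candidate)"
    "rel (\<lambda>_. 0) \<sigma>2 s2" "loop_inv d b (place n (4 * n)) \<sigma>2" by blast
  have "1 + bcost (cB running) + t1 + t2 \<le>
      (Suc k + 1) * (1 + bcost (cB running) + cost n m try_candidate)"
    using 1(2) 2(2) by simp
  with exec.WhileTrue[OF b 1(1) 2(1)] 2(3,4) show ?case by blast
qed

definition time_bound :: nat where
  "time_bound = 2 + cost n m init + cost n m write_output +
     ((6 * (n + 1)\<^sup>2) ^ n + 1) * (1 + bcost (cB running) + cost n m try_candidate)"

lemma exec_program:
  assumes d: "digits n (4 * n) d"
    and z: "z 0 = 0" "\<And>v. v < n \<Longrightarrow> lin (decode n d v) z = rhs n d v"
    and uniq: "\<And>y. y 0 = 0 \<Longrightarrow> \<forall>v<n. lin (decode n d v) y = 0 \<Longrightarrow> \<forall>u\<le>n. y u = 0"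
    and s: "\<And>i. i \<le> hi \<Longrightarrow> fst s i = inN i" "\<And>i. hi < i \<Longrightarrow> fst s i = 0"
      "\<And>i. i < m \<Longrightarrow> snd s i = wt i" "\<And>i. m \<le> i \<Longrightarrow> snd s i = 0"
  shows "\<exists>t s'. exec program s t s' \<and> t \<le> time_bound \<and> (\<forall>u\<le>n. snd s' u \<in> {0..1}) \<and>
    loss (snd s') \<le> loss (normalize n z)"
proof -
  let ?b = "loss (normalize n z)" and ?N = "place n (4 * n)"
  \<comment> \<open>All weights lie below address \<open>hi\<close>, so the cells of the arrays
    start at zero.\<close>
  define \<sigma> :: store where "\<sigma> = (\<lambda>_ _. 0, \<lambda>x i. if x = IO then snd s i else 0)"
  have m: "m \<le> hi" by (simp add: hi_def)
  have rel0: "rel (\<lambda>_. 0) \<sigma> s" using s m by (simp add: rel_def \<sigma>_def)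
  have "scoped {} init" "scoped {} write_output" by (simp_all add: mod_simps)
  from exec_comp[OF this(1) _ rel0] obtain t1 s1 where
    1: "exec (comp init) s t1 s1" "t1 \<le> cost n m init" "rel (\<lambda>_. 0) (run init (\<lambda>_. 0) \<sigma>) s1" by blast
  have inv: "loop_inv d ?b 0 (run init (\<lambda>_. 0) \<sigma>)"
    by (rule loop_inv_init) (use s in \<open>auto simp: \<sigma>_def\<close>)
  have "0 + ?N = ?N" by simp
  from exec_loop[OF loop_inv_step[OF d z uniq] this inv 1(3)] obtain t2 s2 \<sigma>2 where
    2: "exec (While (cB running) (comp try_candidate)) s1 t2 s2"
    "t2 \<le> (?N + 1) * (1 + bcost (cB running) + cost n m try_candidate)"
    "rel (\<lambda>_. 0) \<sigma>2 s2" "loop_inv d ?b ?N \<sigma>2" by blast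
  from exec_comp[OF \<open>scoped {} write_output\<close> _ 2(3)] obtain t3 s3 where
    3: "exec (comp write_output) s2 t3 s3" "t3 \<le> cost n m write_output"
    "rel (\<lambda>_. 0) (run write_output (\<lambda>_. 0) \<sigma>2) s3" by blast
  have out: "snd s3 u = snd \<sigma>2 Best u" if "u \<le> n" for u
  proof -
    have "u \<le> hi" using that by (simp add: hi_def)
    then have "snd s3 u = snd (run write_output (\<lambda>_. 0) \<sigma>2) IO u" using 3(3) by (simp add: rel_def)
    then show ?thesis using run_write_output[OF that] by simp
  qed
  have "loss (snd s3) = loss (snd \<sigma>2 Best)" by (rule loss_cong) (rule out)
  also have "\<dots> \<le> ?b" using 2(4) code_less[OF d] by (simp add: loop_inv_def)
  finally have "loss (snd s3) \<le> ?b" .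
  moreover have "\<forall>u\<le>n. snd s3 u \<in> {0..1}" using 2(4) out by (simp add: loop_inv_def)
  moreover have "1 + t1 + (1 + t2 + t3) \<le> time_bound"
    using 1(2) 2(2) 3(2) unfolding time_bound_def place_total by linarith
  moreover have "exec program s (1 + t1 + (1 + t2 + t3)) s3"
    unfolding program_def by (rule exec.Seq[OF 1(1) exec.Seq[OF 2(1) 3(1)]])
  ultimately show ?thesis by blast
qed

end

section \<open>Input layout and conclusion\<close>

lemma concat_triples:
  "length (concat (map (\<lambda>(i, j, k). [i, j, k]) ts)) = 3 * length ts"
  by (induction ts) auto

lemma concat_triples_nth:
  assumes "q < length ts"
  shows "(concat (map (\<lambda>(i, j, k). [i, j, k]) ts) ! (3 * q),
    concat (map (\<lambda>(i, j, k). [i, j, k]) ts) ! Suc (3 * q),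
    concat (map (\<lambda>(i, j, k). [i, j, k]) ts) ! Suc (Suc (3 * q))) = ts ! q"
  using assms
proof (induction ts arbitrary: q)
  case (Cons \<tau> ts)
  then show ?case by (cases q; cases \<tau>) auto
qed simp

lemma violated_weight_list:
  assumes "distinct ts"
  shows "violated_weight (set ts) w x = (\<Sum>q<length ts. if violates x (ts ! q) then w (ts ! q) else 0)"
proof -
  have "violated_weight (set ts) w x = (\<Sum>\<tau>\<in>set ts. if violates x \<tau> then w \<tau> else 0)"
    unfolding violated_weight_def by (rule sum.inter_filter) simp
  then show ?thesis
    using sum.reindex_bij_betw[OF bij_betw_nth[OF assms refl refl],
        of "\<lambda>\<tau>. if violates x \<tau> then w \<tau> else 0"] by simp
qed

lemma instance_card:
  assumes "wlloc_instance n (set ts)" "distinct ts"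
  shows "length ts \<le> n ^ 3"
proof -
  have "set ts \<subseteq> {1..n} \<times> {1..n} \<times> {1..n}" using assms(1) by (auto simp: wlloc_instance_def)
  then have "card (set ts) \<le> card ({1..n} \<times> {1..n} \<times> {1..n})" by (intro card_mono) auto
  then show ?thesis using assms(2) by (simp add: distinct_card power3_eq_cube)
qed

text \<open>An optimum shares its signs with a vertex \<open>z\<close>, so the normalized
  \<open>z\<close> has the same loss, and \<open>z\<close> solves the system of some digit vector
  \<open>d\<close>. Trying \<open>d\<close> therefore makes the output at least as good as the
  optimum.\<close>

lemma program_correct:
  assumes inst: "wlloc_instance n (set ts)" and dist: "distinct ts"
  shows "\<exists>t s. exec program (input_state n ts w) t s \<and>
    t \<le> 2 + cost n (length ts) init + cost n (length ts) write_output +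
      ((6 * (n + 1)\<^sup>2) ^ n + 1) * (1 + bcost (cB running) + cost n (length ts) try_candidate) \<and>
    optimal_solution n (set ts) w (output_map s)"
proof -
  let ?cs = "concat (map (\<lambda>(i, j, k). [i, j, k]) ts)"
  let ?inN = "load (n # length ts # ?cs)"
  interpret machine n "length ts" ?inN by unfold_locales (simp_all add: load_def)
  have triple: "input_triple q = ts ! q" if "q < length ts" for q
    using concat_triples_nth[OF that] that
    by (simp add: input_triple_def load_def concat_triples numeral_eq_Suc)
  have pts: "ts ! q \<in> points n" if "q < length ts" for q
    using inst nth_mem[OF that] by (auto simp: wlloc_instance_def points_def)
  interpret wlloc_machine n "length ts" ?inN "\<lambda>q. w (ts ! q)"
    by unfold_locales (simp add: triple pts)
  have loss: "loss x = violated_weight (set ts) w x" for x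
    unfolding loss_def violated_weight_list[OF dist] using triple by (intro sum.cong) auto
  have sub: "set ts \<subseteq> points n" using pts by (metis in_set_conv_nth subsetI)
  obtain f where f: "optimal_solution n (set ts) w f" using optimal_solution_exists by blast
  then have f01: "f \<in> {1..n} \<rightarrow> {0..1}"
    and opt: "\<And>g. g \<in> {1..n} \<rightarrow> {0..1} \<Longrightarrow> violated_weight (set ts) w f \<le> violated_weight (set ts) w g"
    by (auto simp: optimal_solution_def is_arg_min_linorder)
  \<comment> \<open>A solution is constrained on \<open>{1..n}\<close> alone; resetting it at the
    auxiliary point affects no constraint, as no triple of an instance contains
    \<open>0\<close>.\<close>
  define f' where "f' = f(0 := 0)"
  have "violates f' \<tau> = violates f \<tau>" if "\<tau> \<in> set ts" for \<tau>
  proof -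
    obtain i j k where \<tau>: "\<tau> = (i, j, k)" by (cases \<tau>)
    from subsetD[OF inst[unfolded wlloc_instance_def] that] have "i \<noteq> 0" "j \<noteq> 0" "k \<noteq> 0"
      by (simp_all add: \<tau>)
    then show ?thesis by (simp add: \<tau> violates_def f'_def)
  qed
  then have f': "violated_weight (set ts) w f' = violated_weight (set ts) w f"
    unfolding violated_weight_def by (metis (mono_tags, lifting) Collect_cong)
  have "f' 0 = 0" by (simp add: f'_def)
  then obtain z d where z: "z 0 = 0" "\<forall>\<tau>\<in>points n. sgn (lin \<tau> z) = sgn (lin \<tau> f')"
    and d: "digits n (4 * n) d" "\<And>v. v < n \<Longrightarrow> lin (decode n d v) z = rhs n d v"
      "\<And>y. y 0 = 0 \<Longrightarrow> \<forall>v<n. lin (decode n d v) y = 0 \<Longrightarrow> \<forall>u\<le>n. y u = 0"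
    using vertex_digits_exist[of f' n] by blast
  \<comment> \<open>Equal signs of the forms of \<open>(u, 0, 0)\<close> transfer nonnegativity from
    \<open>f'\<close> to \<open>z\<close>, so truncation does not alter \<open>z\<close>.\<close>
  have z_nonneg: "0 \<le> z u" if "u \<le> n" for u
  proof -
    have "(u, 0, 0) \<in> points n" using that by (simp add: points_def)
    then have "sgn (lin (u, 0, 0) z) = sgn (lin (u, 0, 0) f')" using z(2) by blast
    then have "sgn (z u) = sgn (f' u)" using z(1) by (simp add: lin_def f'_def sgn_mult)
    moreover have "0 \<le> f' u" using f01 that by (cases u) (auto simp: f'_def Pi_iff)
    ultimately show ?thesis by (metis sgn_less not_less)
  qed
  have zf: "violated_weight (set ts) w (normalize n z) = violated_weight (set ts) w f"
    unfolding f'[symmetric]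
    by (rule violated_weight_cong[OF sub]) (use sgn_lin_normalize[OF z_nonneg] z(2) in simp)
  have "\<exists>t s'. exec program (input_state n ts w) t s' \<and> t \<le> time_bound \<and>
      (\<forall>u\<le>n. snd s' u \<in> {0..1}) \<and> loss (snd s') \<le> loss (normalize n z)"
    by (rule exec_program[OF d(1) z(1) d(2,3)])
      (auto simp: input_state_def load_def hi_def concat_triples)
  then obtain t s where ts: "exec program (input_state n ts w) t s" "t \<le> time_bound"
    "\<forall>u\<le>n. snd s u \<in> {0..1}" "violated_weight (set ts) w (snd s) \<le> violated_weight (set ts) w f"
    unfolding loss zf by blast
  have "snd s \<in> {1..n} \<rightarrow> {0..1}" using ts(3) by auto
  moreover have "violated_weight (set ts) w (snd s) \<le> violated_weight (set ts) w g"
    if "g \<in> {1..n} \<rightarrow> {0..1}" for g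
    using ts(4) opt[OF that] by simp
  ultimately have "optimal_solution n (set ts) w (output_map s)"
    by (simp add: optimal_solution_def output_map_def is_arg_min_linorder)
  with ts(1,2) show ?thesis unfolding time_bound_def by blast
qed

text \<open>The bound can depend on \<open>n\<close> alone because distinct triples number at most
  \<open>n ^ 3\<close>.\<close>

theorem theorem3:
  "\<exists>(c :: com) (time :: nat \<Rightarrow> nat).
     (\<lambda>n. real (time n)) \<in> O(\<lambda>n. real n ^ (3 * n)) \<and>
     (\<forall>(n :: nat) (T :: triple set) (w :: triple \<Rightarrow> real) (ts :: triple list).
        wlloc_instance n T \<longrightarrow> distinct ts \<longrightarrow> set ts = T \<longrightarrow>
        (\<exists>t s. exec c (input_state n ts w) t s \<and> t \<le> time n \<and>
               optimal_solution n T w (output_map s)))"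
proof -
  obtain B1 where B1: "\<And>n m. m \<le> n ^ 3 \<Longrightarrow> cost n m init \<le> B1 * (n + 1) ^ deg init"
    using cost_poly[of init] by blast
  obtain B2 where B2: "\<And>n m. m \<le> n ^ 3 \<Longrightarrow> cost n m write_output \<le> B2 * (n + 1) ^ deg write_output"
    using cost_poly[of write_output] by blast
  obtain B3 where B3: "\<And>n m. m \<le> n ^ 3 \<Longrightarrow> cost n m try_candidate \<le> B3 * (n + 1) ^ deg try_candidate"
    using cost_poly[of try_candidate] by blast
  define time where "time n = 2 + B1 * (n + 1) ^ deg init + B2 * (n + 1) ^ deg write_output +
    ((6 * (n + 1)\<^sup>2) ^ n + 1) * (1 + bcost (cB running) + B3 * (n + 1) ^ deg try_candidate)" for n
  \<comment> \<open>\<open>(n + 1) ^ (2 * n)\<close> is of order \<open>n ^ (2 * n)\<close>, and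
    \<open>6 ^ n\<close> times any polynomial is dominated by the remaining
    \<open>n ^ n\<close>.\<close>
  have "(\<lambda>n. 2 + real B1 * (real n + 1) ^ a + real B2 * (real n + 1) ^ b +
      ((6 * (real n + 1)\<^sup>2) ^ n + 1) * (1 + real r + real B3 * (real n + 1) ^ c))
      \<in> O(\<lambda>n. real n ^ (3 * n))" for a b c r :: nat
    by real_asymp
  then have "(\<lambda>n. real (time n)) \<in> O(\<lambda>n. real n ^ (3 * n))"
    by (simp only: time_def of_nat_add of_nat_mult of_nat_power of_nat_1 of_nat_numeral)
  moreover have "\<exists>t s. exec program (input_state n ts w) t s \<and> t \<le> time n \<and>
      optimal_solution n (set ts) w (output_map s)"
    if inst: "wlloc_instance n (set ts)" and dist: "distinct ts" for n w and ts :: "triple list"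
  proof -
    have m: "length ts \<le> n ^ 3" by (rule instance_card[OF inst dist])
    obtain t s where ts: "exec program (input_state n ts w) t s"
      "t \<le> 2 + cost n (length ts) init + cost n (length ts) write_output +
        ((6 * (n + 1)\<^sup>2) ^ n + 1) * (1 + bcost (cB running) + cost n (length ts) try_candidate)"
      "optimal_solution n (set ts) w (output_map s)"
      using program_correct[OF inst dist] by blast
    have "2 + cost n (length ts) init + cost n (length ts) write_output +
        ((6 * (n + 1)\<^sup>2) ^ n + 1) * (1 + bcost (cB running) + cost n (length ts) try_candidate) \<le> time n"
      unfolding time_def using B1[OF m] B2[OF m] B3[OF m] by (intro add_mono mult_mono) auto
    then show ?thesis using ts by (meson order_trans)
  qed
  ultimately show ?thesis by blast
qed

end
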